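(* Let $\mathscr{X}_0\subseteq X^{\odot\star}$ be an admissible range for $\{T_0(t)\}_{t\ge0}$, let $L:X\to X^{\odot\star}$ be a bounded linear operator taking its values in $\mathscr{X}_0$, and let $\{T(t)\}_{t\ge0}$ be the $\mathcal{C}_0$-semigroup on $X$ obtained from $\{T_0(t)\}_{t\ge0}$ by perturbation with $L$. Let $0<t_e\le\infty$. Then the following two statements hold. (i) $\mathscr{X}_0$ is an admissible range for $\{T(t)\}_{t\ge0}$. (ii) For every $\phi\in X$ and every norm-continuous $f:[0,t_e)\to\mathscr{X}_0$, the unique continuous function $u:[0,t_e)\to X$ satisfying $$u(t)=T_0(t)\phi+j^{-1}\int_0^tT_0^{\odot\star}(t-\tau)[Lu(\tau)+f(\tau)]\,d\tau\qquad\text{for all }t\in[0,t_e)$$ is given by $$u(t)=T(t)\phi+j^{-1}\int_0^tT^{\odot\star}(t-\tau)f(\tau)\,d\tau,\qquad t\in[0,t_e).$$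
   Context: All intervals are non-degenerate but otherwise arbitrary. For a Banach space $E$, $\langle x,x^\star\rangle:=x^\star(x)$ for $x\in E$, $x^\star\in E^\star$. Let $\{T_0(t)\}_{t\ge 0}$ be a $\mathcal{C}_0$-semigroup of bounded linear operators on a real or complex Banach space $X$. The sun dual is $X^\odot:=\{x^\star\in X^\star: \lim_{t\downarrow 0}\|T_0(t)^\star x^\star-x^\star\|=0\}$, a norm-closed subspace of $X^\star$ invariant under all $T_0(t)^\star$; $T_0^\odot(t)$ is the restriction of $T_0(t)^\star$ to $X^\odot$ (a $\mathcal{C}_0$-semigroup); $X^{\odot\star}:=(X^\odot)^\star$, $T_0^{\odot\star}(t):=(T_0^\odot(t))^\star$. The canonical embedding $j:X\to X^{\odot\star}$ is $\langle x^\odot,jx\rangle:=\langle x,x^\odot\rangle$; it is injective with norm-closed range $jX$, and $j^{-1}:jX\to X$. It is not assumed that $X$ is sun-reflexive. A closed subspace $\mathscr{X}_0$ of $X^{\odot\star}$ is an admissible range for a $\mathcal{C}_0$-semigroup $\{U(t)\}$ on $X$ (with sun dual $X^\odot$) if, for some (equivalently, for every) interval $J$, for every norm-continuous $f:J\to\mathscr{X}_0$ and all $s\le t$ in $J$ the weak$^\star$ integral $\int_s^tU^{\odot\star}(t-\tau)f(\tau)\,d\tau$ belongs to $jX$; here $\langle x^\odot,\int_s^tq(\tau)d\tau\rangle:=\int_s^t\langle x^\odot,q(\tau)\rangle d\tau$ for all $x^\odot\in X^\odot$. The perturbed semigroup: for $L:X\to\mathscr{X}_0$ bounded linear there is a unique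 $\mathcal{C}_0$-semigroup $\{T(t)\}_{t\ge0}$ on $X$ with $T(t)x=T_0(t)x+j^{-1}\int_0^tT_0^{\odot\star}(t-\tau)LT(\tau)x\,d\tau$ for all $x\in X$, $t\ge0$. The sun duals of $X$ with respect to $\{T_0(t)\}$ and $\{T(t)\}$ coincide, so $T^{\odot\star}(t)$ acts on the same space $X^{\odot\star}$ and $j$ is the same map. *)

theory Defs
  imports "HOL-Analysis.Analysis" "HOL-Library.Function_Algebras"
begin

text \<open>
  A Banach space over the real or complex field: a type of class \<open>banach\<close> with a scalar
  multiplication by \<open>'k\<close> that extends \<open>scaleR\<close>. By the Gelfand--Mazur theorem the types of class
  \<open>real_normed_field\<close> are, up to isometric isomorphism, exactly the real and the complex
  numbers, so a type variable of this sort covers both cases at once; the class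
  \<open>euclidean_space\<close> has both as instances and excludes neither.
\<close>

locale banach_over = vector_space sc
  for sc :: "'k::{real_normed_field,euclidean_space} \<Rightarrow> 'a::banach \<Rightarrow> 'a" +
  assumes norm_sc: "norm (sc c x) = norm c * norm x"
    and sc_of_real: "sc (of_real r) x = r *\<^sub>R x"

lemma banach_over_real: "banach_over (scaleR :: real \<Rightarrow> 'a::banach \<Rightarrow> 'a)"
  by unfold_locales (auto simp: algebra_simps)

lemma banach_over_complex: "banach_over ((*) :: complex \<Rightarrow> complex \<Rightarrow> complex)"
  by unfold_locales (auto simp: algebra_simps norm_mult scaleR_conv_of_real)

text \<open>
  Elements of \<open>'a \<Rightarrow>\<^sub>L 'b\<close> are bounded and real-linear; linearity over \<open>'k\<close> is imposed
  separately. A semigroup is a function on all of \<open>real\<close>, of which only the values at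
  nonnegative arguments matter.
\<close>

definition C0_semigroup ::
  "('k::{real_normed_field,euclidean_space} \<Rightarrow> 'a::banach \<Rightarrow> 'a) \<Rightarrow> (real \<Rightarrow> 'a \<Rightarrow>\<^sub>L 'a) \<Rightarrow> bool"
where
  "C0_semigroup sc T \<longleftrightarrow>
     (\<forall>t\<ge>0. Vector_Spaces.linear sc sc (blinfun_apply (T t))) \<and>
     T 0 = id_blinfun \<and>
     (\<forall>s\<ge>0. \<forall>t\<ge>0. T (s + t) = T s o\<^sub>L T t) \<and>
     (\<forall>x. ((\<lambda>t. T t x) \<longlongrightarrow> x) (at_right 0))"

definition dual_space ::
  "('k::{real_normed_field,euclidean_space} \<Rightarrow> 'a::banach \<Rightarrow> 'a) \<Rightarrow> ('a \<Rightarrow>\<^sub>L 'k) set"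
where
  "dual_space sc = {x'. Vector_Spaces.linear sc (*) (blinfun_apply x')}"

text \<open>The adjoint of \<open>T t\<close> sends \<open>x'\<close> to \<open>x' o\<^sub>L T t\<close>.\<close>

definition sun_dual ::
  "('k::{real_normed_field,euclidean_space} \<Rightarrow> 'a::banach \<Rightarrow> 'a) \<Rightarrow> (real \<Rightarrow> 'a \<Rightarrow>\<^sub>L 'a)
     \<Rightarrow> ('a \<Rightarrow>\<^sub>L 'k) set"
where
  "sun_dual sc T =
     {x' \<in> dual_space sc. ((\<lambda>t. norm ((x' o\<^sub>L T t) - x')) \<longlongrightarrow> 0) (at_right 0)}"

text \<open>
  The sun dual is not a type, so a functional on it is represented by a function on the whole type
  \<open>'a \<Rightarrow>\<^sub>L 'k\<close> that vanishes outside the sun dual. (Zero, rather than \<open>undefined\<close>, makes this set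
  closed under the pointwise operations on functions.) The scalar multiple of \<open>x'\<close> by \<open>c\<close> is
  \<open>blinfun_mult_right c o\<^sub>L x'\<close>.
\<close>

definition sun_star ::
  "('k::{real_normed_field,euclidean_space} \<Rightarrow> 'a::banach \<Rightarrow> 'a) \<Rightarrow> (real \<Rightarrow> 'a \<Rightarrow>\<^sub>L 'a)
     \<Rightarrow> (('a \<Rightarrow>\<^sub>L 'k) \<Rightarrow> 'k) set"
where
  "sun_star sc T = {F.
     (\<forall>x'\<in>sun_dual sc T. \<forall>y'\<in>sun_dual sc T. F (x' + y') = F x' + F y') \<and>
     (\<forall>c. \<forall>x'\<in>sun_dual sc T. F (blinfun_mult_right c o\<^sub>L x') = c * F x') \<and>
     (\<exists>K. \<forall>x'\<in>sun_dual sc T. norm (F x') \<le> K * norm x') \<and>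
     (\<forall>x'. x' \<notin> sun_dual sc T \<longrightarrow> F x' = 0)}"

definition sun_star_norm ::
  "('k::{real_normed_field,euclidean_space} \<Rightarrow> 'a::banach \<Rightarrow> 'a) \<Rightarrow> (real \<Rightarrow> 'a \<Rightarrow>\<^sub>L 'a)
     \<Rightarrow> (('a \<Rightarrow>\<^sub>L 'k) \<Rightarrow> 'k) \<Rightarrow> real"
where
  "sun_star_norm sc T F = (SUP x'\<in>{x' \<in> sun_dual sc T. norm x' \<le> 1}. norm (F x'))"

definition fun_scale :: "'k::real_normed_field \<Rightarrow> ('b \<Rightarrow> 'k) \<Rightarrow> 'b \<Rightarrow> 'k" where
  "fun_scale c F = (\<lambda>x. c * F x)"

lemma vector_space_fun_scale: "vector_space fun_scale"
  by unfold_locales (auto simp: fun_scale_def fun_eq_iff algebra_simps)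

definition sun_star_semigroup ::
  "('k::{real_normed_field,euclidean_space} \<Rightarrow> 'a::banach \<Rightarrow> 'a) \<Rightarrow> (real \<Rightarrow> 'a \<Rightarrow>\<^sub>L 'a)
     \<Rightarrow> real \<Rightarrow> (('a \<Rightarrow>\<^sub>L 'k) \<Rightarrow> 'k) \<Rightarrow> (('a \<Rightarrow>\<^sub>L 'k) \<Rightarrow> 'k)"
where
  "sun_star_semigroup sc T t F = (\<lambda>x'. if x' \<in> sun_dual sc T then F (x' o\<^sub>L T t) else 0)"

text \<open>
  The canonical embedding \<open>j\<close>. Its inverse is written \<open>inv (sun_emb sc T)\<close> and is only meaningful
  on \<open>range (sun_emb sc T)\<close>.
\<close>

definition sun_emb ::
  "('k::{real_normed_field,euclidean_space} \<Rightarrow> 'a::banach \<Rightarrow> 'a) \<Rightarrow> (real \<Rightarrow> 'a \<Rightarrow>\<^sub>L 'a)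
     \<Rightarrow> 'a \<Rightarrow> (('a \<Rightarrow>\<^sub>L 'k) \<Rightarrow> 'k)"
where
  "sun_emb sc T x = (\<lambda>x'. if x' \<in> sun_dual sc T then x' x else 0)"

definition weak_star_integral ::
  "('k::{real_normed_field,euclidean_space} \<Rightarrow> 'a::banach \<Rightarrow> 'a) \<Rightarrow> (real \<Rightarrow> 'a \<Rightarrow>\<^sub>L 'a)
     \<Rightarrow> real \<Rightarrow> real \<Rightarrow> (real \<Rightarrow> ('a \<Rightarrow>\<^sub>L 'k) \<Rightarrow> 'k) \<Rightarrow> (('a \<Rightarrow>\<^sub>L 'k) \<Rightarrow> 'k)"
where
  "weak_star_integral sc T s t q =
     (\<lambda>x'. if x' \<in> sun_dual sc T then integral {s..t} (\<lambda>\<tau>. q \<tau> x') else 0)"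

definition sun_star_convolution ::
  "('k::{real_normed_field,euclidean_space} \<Rightarrow> 'a::banach \<Rightarrow> 'a) \<Rightarrow> (real \<Rightarrow> 'a \<Rightarrow>\<^sub>L 'a)
     \<Rightarrow> (real \<Rightarrow> ('a \<Rightarrow>\<^sub>L 'k) \<Rightarrow> 'k) \<Rightarrow> real \<Rightarrow> real \<Rightarrow> (('a \<Rightarrow>\<^sub>L 'k) \<Rightarrow> 'k)"
where
  "sun_star_convolution sc T f s t =
     weak_star_integral sc T s t (\<lambda>\<tau>. sun_star_semigroup sc T (t - \<tau>) (f \<tau>))"

definition norm_continuous_on ::
  "('k::{real_normed_field,euclidean_space} \<Rightarrow> 'a::banach \<Rightarrow> 'a) \<Rightarrow> (real \<Rightarrow> 'a \<Rightarrow>\<^sub>L 'a)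
     \<Rightarrow> real set \<Rightarrow> (real \<Rightarrow> ('a \<Rightarrow>\<^sub>L 'k) \<Rightarrow> 'k) \<Rightarrow> bool"
where
  "norm_continuous_on sc T J f \<longleftrightarrow>
     (\<forall>t\<in>J. ((\<lambda>s. sun_star_norm sc T (f s - f t)) \<longlongrightarrow> 0) (at t within J))"

definition closed_sun_star_subspace ::
  "('k::{real_normed_field,euclidean_space} \<Rightarrow> 'a::banach \<Rightarrow> 'a) \<Rightarrow> (real \<Rightarrow> 'a \<Rightarrow>\<^sub>L 'a)
     \<Rightarrow> (('a \<Rightarrow>\<^sub>L 'k) \<Rightarrow> 'k) set \<Rightarrow> bool"
where
  "closed_sun_star_subspace sc T S \<longleftrightarrow>
     S \<subseteq> sun_star sc T \<and>
     module.subspace fun_scale S \<and>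
     (\<forall>G F. (\<forall>n::nat. G n \<in> S) \<and> F \<in> sun_star sc T \<and>
        (\<lambda>n. sun_star_norm sc T (G n - F)) \<longlonglongrightarrow> 0 \<longrightarrow> F \<in> S)"

definition admissible_range ::
  "('k::{real_normed_field,euclidean_space} \<Rightarrow> 'a::banach \<Rightarrow> 'a) \<Rightarrow> (real \<Rightarrow> 'a \<Rightarrow>\<^sub>L 'a)
     \<Rightarrow> (('a \<Rightarrow>\<^sub>L 'k) \<Rightarrow> 'k) set \<Rightarrow> bool"
where
  "admissible_range sc U S \<longleftrightarrow>
     closed_sun_star_subspace sc U S \<and>
     (\<exists>J. is_interval J \<and> (\<exists>a\<in>J. \<exists>b\<in>J. a < b) \<and>
        (\<forall>f. norm_continuous_on sc U J f \<and> f ` J \<subseteq> S \<longrightarrow>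
           (\<forall>s\<in>J. \<forall>t\<in>J. s \<le> t \<longrightarrow>
              sun_star_convolution sc U f s t \<in> range (sun_emb sc U))))"

definition bounded_linear_into_sun_star ::
  "('k::{real_normed_field,euclidean_space} \<Rightarrow> 'a::banach \<Rightarrow> 'a) \<Rightarrow> (real \<Rightarrow> 'a \<Rightarrow>\<^sub>L 'a)
     \<Rightarrow> ('a \<Rightarrow> ('a \<Rightarrow>\<^sub>L 'k) \<Rightarrow> 'k) \<Rightarrow> bool"
where
  "bounded_linear_into_sun_star sc T L \<longleftrightarrow>
     range L \<subseteq> sun_star sc T \<and>
     Vector_Spaces.linear sc fun_scale L \<and>
     (\<exists>K. \<forall>x. sun_star_norm sc T (L x) \<le> K * norm x)"

text \<open>
  The equation below determines the \<open>C\<^sub>0\<close>-semigroup \<open>T\<close> on nonnegative arguments, so this predicate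
  expresses that \<open>T\<close> is the semigroup obtained from \<open>T0\<close> by perturbation with \<open>L\<close>.
\<close>

definition perturbed_semigroup ::
  "('k::{real_normed_field,euclidean_space} \<Rightarrow> 'a::banach \<Rightarrow> 'a) \<Rightarrow> (real \<Rightarrow> 'a \<Rightarrow>\<^sub>L 'a)
     \<Rightarrow> ('a \<Rightarrow> ('a \<Rightarrow>\<^sub>L 'k) \<Rightarrow> 'k) \<Rightarrow> (real \<Rightarrow> 'a \<Rightarrow>\<^sub>L 'a) \<Rightarrow> bool"
where
  "perturbed_semigroup sc T0 L T \<longleftrightarrow>
     C0_semigroup sc T \<and>
     (\<forall>x. \<forall>t\<ge>0. T t x =
        T0 t x + inv (sun_emb sc T0) (sun_star_convolution sc T0 (\<lambda>\<tau>. L (T \<tau> x)) 0 t))"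

definition mild_solution_on ::
  "real set \<Rightarrow> ('k::{real_normed_field,euclidean_space} \<Rightarrow> 'a::banach \<Rightarrow> 'a)
     \<Rightarrow> (real \<Rightarrow> 'a \<Rightarrow>\<^sub>L 'a) \<Rightarrow> ('a \<Rightarrow> ('a \<Rightarrow>\<^sub>L 'k) \<Rightarrow> 'k) \<Rightarrow> 'a \<Rightarrow> (real \<Rightarrow> ('a \<Rightarrow>\<^sub>L 'k) \<Rightarrow> 'k)
     \<Rightarrow> (real \<Rightarrow> 'a) \<Rightarrow> bool"
where
  "mild_solution_on I sc T0 L \<phi> f u \<longleftrightarrow>
     continuous_on I u \<and>
     (\<forall>t\<in>I. u t =
        T0 t \<phi> + inv (sun_emb sc T0) (sun_star_convolution sc T0 (\<lambda>\<tau>. L (u \<tau>) + f \<tau>) 0 t))"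

end

theory Submission
  imports Defs
begin

text \<open>
  Write \<open>w(s, t)\<close> for the weak-star integral of \<open>T\<^sup>\<odot>\<^sup>*(t - \<tau>) f(\<tau>)\<close> over \<open>[s, t]\<close> and \<open>w\<^sub>0(s, t)\<close> for
  the one formed with \<open>T\<^sub>0\<close>. Both are cocycles, \<open>w(s, u) = T\<^sup>\<odot>\<^sup>*(u - t) w(s, t) + w(t, u)\<close>
  (\<open>conv_split\<close>), and the perturbation is small over short times: \<open>T(t) - T\<^sub>0(t)\<close> is \<open>j\<^sup>-\<^sup>1\<close> of an
  integral over \<open>[0, t]\<close> with bounded integrand, and \<open>j\<close> is bounded below, so its norm is at most
  \<open>C t\<close> (\<open>semigroups_close\<close>). Hence the sun duals agree (\<open>sun_dual_eq\<close>), and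
  \<open>w(a, b) - w\<^sub>0(a, b)\<close> has norm of order \<open>(b - a)\<^sup>2\<close> (\<open>conv_close\<close>).

  For (i), cut \<open>[s, t]\<close> into \<open>n\<close> equal pieces, expand \<open>w(s, t)\<close> by the cocycle identity and replace
  \<open>w\<close> by \<open>w\<^sub>0\<close> on every piece. The result lies in \<open>jX\<close>, because \<open>w\<^sub>0\<close> does and \<open>jX\<close> is invariant; the
  \<open>n\<close> errors of order \<open>1/n\<^sup>2\<close> add up to order \<open>1/n\<close>. As \<open>jX\<close> is norm closed, \<open>w(s, t) \<in> jX\<close>
  (\<open>convolution_in_range_if_locally\<close>, \<open>perturbed_convolution_in_range\<close>).

  For (ii), the same idea acts on functions in \<open>X\<close>: if \<open>e(0) = 0\<close> and \<open>e(b) - U(b - a) e(a)\<close> has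
  order \<open>(b - a)\<^sup>2\<close> for a semigroup \<open>U\<close>, then \<open>s \<mapsto> U(t - s) e(s)\<close> has derivative zero and so \<open>e = 0\<close>
  (\<open>orbit_defect_zero\<close>). With \<open>U = T\<^sub>0\<close> it shows that \<open>u\<^sub>0 = T(\<cdot>)\<phi> + j\<^sup>-\<^sup>1 w(0, \<cdot>)\<close> equals the right-hand
  side of the equation formed from \<open>u\<^sub>0\<close> (\<open>u0_mild\<close>); with \<open>U = T\<close> it shows that the difference of two
  solutions vanishes (\<open>mild_unique\<close>).

  That \<open>j\<close> is bounded below means that the sun dual is norming (\<open>sun_dual_norming\<close>). This follows
  from the Hahn--Banach theorem, because the averages of the orbit of a functional under the
  adjoint semigroup lie in the sun dual and converge to the functional in the weak-star sense.
  The local bound on a \<open>C\<^sub>0\<close>-semigroup comes from the uniform boundedness principle.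
\<close>

section \<open>Norming functionals\<close>

definition sublinear :: "('a::real_vector \<Rightarrow> real) \<Rightarrow> bool" where
  "sublinear p \<longleftrightarrow> (\<forall>x y. p (x + y) \<le> p x + p y) \<and> (\<forall>c>0. \<forall>x. p (c *\<^sub>R x) \<le> c * p x)"

lemma sublinear_add: "sublinear p \<Longrightarrow> p (x + y) \<le> p x + p y"
  and sublinear_scaleR: "sublinear p \<Longrightarrow> c > 0 \<Longrightarrow> p (c *\<^sub>R x) \<le> c * p x"
  by (auto simp: sublinear_def)

lemma sublinear_zero: "sublinear p \<Longrightarrow> p 0 = 0"
  using sublinear_scaleR[of p 2 0] sublinear_scaleR[of p "1/2" 0] by simp

lemma sublinear_minus: "sublinear p \<Longrightarrow> - p (- x) \<le> p x"
  using sublinear_add[of p x "- x"] sublinear_zero[of p] by simp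

lemma sublinear_scaleR_eq:
  assumes "sublinear p" "c > 0"
  shows "p (c *\<^sub>R x) = c * p x"
proof (rule antisym)
  show "p (c *\<^sub>R x) \<le> c * p x" by (rule sublinear_scaleR) fact+
  have "p ((1/c) *\<^sub>R (c *\<^sub>R x)) \<le> (1/c) * p (c *\<^sub>R x)"
    using assms by (intro sublinear_scaleR) auto
  then show "c * p x \<le> p (c *\<^sub>R x)" using assms by (simp add: field_simps)
qed

text \<open>The descent step of the Hahn--Banach theorem: the infimum of \<open>p (x + t *\<^sub>R y) - t * p y\<close> over
  \<open>t \<ge> 0\<close> is again sublinear and is tight at \<open>- y\<close>. A minimal sublinear function therefore
  satisfies \<open>p (- y) = - p y\<close> for every \<open>y\<close>, that is, it is linear.\<close>
lemma exists_sublinear_le_minus: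
  fixes p :: "'a::real_vector \<Rightarrow> real"
  assumes p: "sublinear p"
  shows "\<exists>r. sublinear r \<and> r \<le> p \<and> r (- y) \<le> - p y"
proof -
  define r where "r x = (INF t\<in>{0..}. p (x + t *\<^sub>R y) - t * p y)" for x
  have low: "- p (- x) \<le> p (x + t *\<^sub>R y) - t * p y" if "t \<ge> 0" for x t
  proof (cases "t = 0")
    case False
    then have "t * p y = p (t *\<^sub>R y)" using that sublinear_scaleR_eq[OF p, of t y] by simp
    also have "\<dots> \<le> p (x + t *\<^sub>R y) + p (- x)"
      using sublinear_add[OF p, of "x + t *\<^sub>R y" "- x"] by simp
    finally show ?thesis by simp
  qed (use sublinear_minus[OF p, of x] in simp)
  have r_le: "r x \<le> p (x + t *\<^sub>R y) - t * p y" if "t \<ge> 0" for x t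
    unfolding r_def using low that by (intro cINF_lower) (auto simp: bdd_below_def)
  have r_ge: "z \<le> r x" if "\<And>t. t \<ge> 0 \<Longrightarrow> z \<le> p (x + t *\<^sub>R y) - t * p y" for z x
    unfolding r_def using that by (intro cINF_greatest) auto
  have "r (x + x') \<le> r x + r x'" for x x'
  proof -
    have "r (x + x') - (p (x + t *\<^sub>R y) - t * p y) \<le> r x'" if t: "t \<ge> 0" for t
    proof (rule r_ge)
      fix t' :: real assume t': "t' \<ge> 0"
      have "r (x + x') \<le> p ((x + x') + (t + t') *\<^sub>R y) - (t + t') * p y"
        using t t' by (intro r_le) simp
      also have "(x + x') + (t + t') *\<^sub>R y = (x + t *\<^sub>R y) + (x' + t' *\<^sub>R y)"
        by (simp add: algebra_simps)
      finally show "r (x + x') - (p (x + t *\<^sub>R y) - t * p y) \<le> p (x' + t' *\<^sub>R y) - t' * p y"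
        using sublinear_add[OF p, of "x + t *\<^sub>R y" "x' + t' *\<^sub>R y"] by (simp add: algebra_simps)
    qed
    then have "r (x + x') - r x' \<le> r x" by (intro r_ge) (auto simp: algebra_simps)
    then show ?thesis by simp
  qed
  moreover have "r (c *\<^sub>R x) \<le> c * r x" if c: "c > 0" for c x
  proof -
    have "r (c *\<^sub>R x) / c \<le> r x"
    proof (rule r_ge)
      fix t :: real assume t: "t \<ge> 0"
      have "r (c *\<^sub>R x) \<le> p (c *\<^sub>R x + (c * t) *\<^sub>R y) - (c * t) * p y"
        using t c by (intro r_le) simp
      also have "c *\<^sub>R x + (c * t) *\<^sub>R y = c *\<^sub>R (x + t *\<^sub>R y)" by (simp add: algebra_simps)
      also have "p \<dots> \<le> c * p (x + t *\<^sub>R y)" by (rule sublinear_scaleR[OF p c])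
      finally show "r (c *\<^sub>R x) / c \<le> p (x + t *\<^sub>R y) - t * p y"
        using c by (simp add: field_simps)
    qed
    then show ?thesis using c by (simp add: field_simps)
  qed
  ultimately have "sublinear r" by (auto simp: sublinear_def)
  moreover have "r \<le> p" using r_le[of 0] by (auto simp: le_fun_def)
  moreover have "r (- y) \<le> - p y" using r_le[of 1 "- y"] sublinear_zero[OF p] by simp
  ultimately show ?thesis by blast
qed

text \<open>Zorn's lemma for the reversed pointwise order. Infima of chains stay real-valued because
  \<open>- q (- x)\<close> is a lower bound for every sublinear function below \<open>q\<close>.\<close>
lemma exists_minimal_sublinear:
  fixes q :: "'a::real_vector \<Rightarrow> real"
  assumes q: "sublinear q"
  shows "\<exists>m. sublinear m \<and> m \<le> q \<and> (\<forall>p. sublinear p \<and> p \<le> m \<longrightarrow> p = m)"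
proof -
  define A where "A = {p. sublinear p \<and> p \<le> q}"
  have "\<exists>m\<in>A. \<forall>a\<in>A. a \<le> m \<longrightarrow> a = m"
  proof (rule predicate_Zorn)
    show "partial_order_on A (relation_of (\<lambda>x y. y \<le> x) A)"
      by (intro partial_order_on_relation_ofI) auto
  next
    fix C assume C: "C \<in> Chains (relation_of (\<lambda>x y. y \<le> x) A)"
    then have CA: "C \<subseteq> A" by (rule Chains_relation_of)
    have lin: "p \<le> p' \<or> p' \<le> p" if "p \<in> C" "p' \<in> C" for p p'
      using C that by (auto simp: Chains_def relation_of_def)
    show "\<exists>u\<in>A. \<forall>a\<in>C. u \<le> a"
    proof (cases "C = {}")
      case True
      then show ?thesis using q by (auto simp: A_def)
    next
      case False
      define u where "u x = (INF p\<in>C. p x)" for x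
      have subl: "sublinear p" "p \<le> q" if "p \<in> C" for p using that CA by (auto simp: A_def)
      have low: "- q (- x) \<le> p x" if "p \<in> C" for p x
        using sublinear_minus[OF subl(1)[OF that], of x] subl(2)[OF that]
        by (smt (verit, best) le_funD)
      have u_le: "u x \<le> p x" if "p \<in> C" for p x
        unfolding u_def using low that by (intro cINF_lower) (auto simp: bdd_below_def)
      have u_ge: "z \<le> u x" if "\<And>p. p \<in> C \<Longrightarrow> z \<le> p x" for z x
        unfolding u_def using that False by (intro cINF_greatest) auto
      have "u (x + y) \<le> u x + u y" for x y
      proof -
        have "u (x + y) - p x \<le> u y" if p: "p \<in> C" for p
        proof (rule u_ge)
          fix p' assume p': "p' \<in> C"
          obtain p'' where p'': "p'' \<in> C" "p'' \<le> p" "p'' \<le> p'" using lin[OF p p'] p p' by auto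
          have "u (x + y) \<le> p'' (x + y)" using u_le p'' by blast
          also have "\<dots> \<le> p'' x + p'' y" using sublinear_add subl p'' by blast
          also have "\<dots> \<le> p x + p' y" using p'' by (intro add_mono) (auto simp: le_fun_def)
          finally show "u (x + y) - p x \<le> p' y" by simp
        qed
        then have "u (x + y) - u y \<le> u x" by (intro u_ge) (auto simp: algebra_simps)
        then show ?thesis by simp
      qed
      moreover have "u (c *\<^sub>R x) \<le> c * u x" if c: "c > 0" for c x
      proof -
        have "u (c *\<^sub>R x) / c \<le> u x"
        proof (rule u_ge)
          fix p assume p: "p \<in> C"
          have "u (c *\<^sub>R x) \<le> p (c *\<^sub>R x)" by (rule u_le) fact
          also have "\<dots> \<le> c * p x" by (rule sublinear_scaleR) (use subl p c in auto)
          finally show "u (c *\<^sub>R x) / c \<le> p x" using c by (simp add: field_simps)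
        qed
        then show ?thesis using c by (simp add: field_simps)
      qed
      ultimately have "sublinear u" by (auto simp: sublinear_def)
      moreover have "u \<le> q" using False u_le subl(2) by (meson equals0I le_funD le_funI order_trans)
      ultimately show ?thesis using u_le by (auto simp: A_def le_fun_def)
    qed
  qed
  then obtain m where m: "sublinear m" "m \<le> q"
    and min: "\<And>a. sublinear a \<Longrightarrow> a \<le> q \<Longrightarrow> a \<le> m \<Longrightarrow> a = m"
    by (auto simp: A_def)
  then show ?thesis by (meson order_trans)
qed

lemma exists_norming_real_functional:
  fixes x :: "'a::real_normed_vector"
  shows "\<exists>f. linear f \<and> (\<forall>y. f y \<le> norm y) \<and> f x = norm x"
proof -
  have "sublinear (norm :: 'a \<Rightarrow> real)" by (auto simp: sublinear_def norm_triangle_ineq)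
  then obtain r :: "'a \<Rightarrow> real" where r: "sublinear r" "r \<le> norm" "r (- x) \<le> - norm x"
    using exists_sublinear_le_minus by blast
  obtain m where m: "sublinear m" "m \<le> r" and min: "\<And>p. sublinear p \<Longrightarrow> p \<le> m \<Longrightarrow> p = m"
    using exists_minimal_sublinear[OF r(1)] by blast
  have odd: "m (- y) = - m y" for y
    using exists_sublinear_le_minus[OF m(1), of y] min sublinear_minus[OF m(1), of y]
    by (smt (verit, ccfv_SIG))
  have add: "m (y + z) = m y + m z" for y z
    using sublinear_add[OF m(1), of y z] sublinear_add[OF m(1), of "- y" "- z"] odd[of y] odd[of z]
      odd[of "y + z"] by simp
  have scale: "m (c *\<^sub>R y) = c * m y" for c y
  proof (cases c "0::real" rule: linorder_cases)
    case less
    then show ?thesis using sublinear_scaleR_eq[OF m(1), of "- c" y] odd[of "c *\<^sub>R y"] by simp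
  qed (use sublinear_scaleR_eq[OF m(1)] sublinear_zero[OF m(1)] in auto)
  have le: "m y \<le> norm y" for y using m(2) r(2) by (meson le_funD order_trans)
  have "m (- x) \<le> - norm x" using m(2) r(3) by (meson le_funD order_trans)
  then have "m x = norm x" using odd[of x] le[of x] by simp
  then show ?thesis using add scale le by (auto intro!: exI[of _ m] linearI)
qed

text \<open>Multiplication by \<open>c\<close> scales all norms by \<open>norm c\<close>, hence by polarisation it scales the inner
  product by the square. In the next lemma this replaces conjugation, treating both fields at once.\<close>
lemma inner_mult_mult:
  fixes c a b :: "'k::{real_normed_field,euclidean_space}"
  shows "(c * a) \<bullet> (c * b) = (norm c)\<^sup>2 * (a \<bullet> b)"
proof -
  have "norm (c * a + c * b) = norm c * norm (a + b)"
    by (simp flip: norm_mult distrib_left)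
  then show ?thesis by (simp add: dot_norm norm_mult power_mult_distrib right_diff_distrib)
qed

text \<open>A real functional \<open>f\<close> becomes linear over \<open>'k\<close> by asking for the scalar \<open>F y\<close> with
  \<open>(c * F y) \<bullet> 1 = f (sc c y)\<close> for all \<open>c\<close>; for the complex field this is the usual
  \<open>F y = f y - \<i> f (\<i> y)\<close>.\<close>
lemma banach_over_norming_functional:
  fixes sc :: "'k::{real_normed_field,euclidean_space} \<Rightarrow> 'a::banach \<Rightarrow> 'a"
  assumes "banach_over sc"
  shows "\<exists>x'\<in>dual_space sc. norm x' \<le> 1 \<and> norm x \<le> norm (blinfun_apply x' x)"
proof -
  interpret banach_over sc by fact
  obtain f where f: "linear f" "\<And>y. f y \<le> norm y" "f x = norm x"
    using exists_norming_real_functional by blast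
  define w where "w y = (\<Sum>b\<in>Basis. f (sc b y) *\<^sub>R b)" for y
  \<comment> \<open>\<open>w y\<close> represents \<open>c \<mapsto> f (sc c y)\<close> as \<open>c \<bullet> w y\<close>. Then \<open>F y\<close> is the conjugate of \<open>w y\<close>,
      expressed by the inverse since \<open>'k\<close> carries no conjugation.\<close>
  define F where "F y = (norm (w y))\<^sup>2 *\<^sub>R inverse (w y)" for y
  have w: "c \<bullet> w y = f (sc c y)" for c y
  proof -
    have "f (sc c y) = f (sc (\<Sum>b\<in>Basis. (c \<bullet> b) *\<^sub>R b) y)" by (simp add: euclidean_representation)
    also have "sc (\<Sum>b\<in>Basis. (c \<bullet> b) *\<^sub>R b) y = (\<Sum>b\<in>Basis. (c \<bullet> b) *\<^sub>R sc b y)"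
      by (simp add: scale_sum_left scaleR_conv_of_real sc_of_real flip: scale_scale)
    also have "f \<dots> = (\<Sum>b\<in>Basis. (c \<bullet> b) * f (sc b y))"
      using f(1) by (simp add: linear_sum linear_cmul)
    also have "\<dots> = c \<bullet> w y" by (simp add: w_def inner_sum_right mult.commute)
    finally show ?thesis by simp
  qed
  have F: "(c * F y) \<bullet> 1 = f (sc c y)" for c y
  proof (cases "w y = 0")
    case True
    then show ?thesis using w[of c y] by (simp add: F_def)
  next
    case False
    have "(c * F y) \<bullet> 1 = (norm (w y))\<^sup>2 * ((inverse (w y) * c) \<bullet> (inverse (w y) * w y))"
      using False by (simp add: F_def mult.commute)
    also have "\<dots> = c \<bullet> w y" using False by (simp only: inner_mult_mult) (simp add: norm_divide field_simps)
    finally show ?thesis using w by simp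
  qed
  have F_unique: "k = F y" if "\<And>c. (c * k) \<bullet> 1 = f (sc c y)" for k y
  proof (rule ccontr)
    assume "k \<noteq> F y"
    then have "1 = inverse (k - F y) * (k - F y)" by simp
    moreover have "(c * (k - F y)) \<bullet> 1 = 0" for c
      using that[of c] F[of c y] by (simp add: algebra_simps)
    ultimately have "(1::'k) \<bullet> 1 = 0" by metis
    then show False by simp
  qed
  have Fadd: "F (y + z) = F y + F z" for y z
    by (rule sym, rule F_unique)
       (simp add: distrib_left inner_add F scale_right_distrib linear_add[OF f(1)])
  have Fsc: "F (sc d y) = d * F y" for d y
    by (rule sym, rule F_unique) (simp add: F flip: mult.assoc)
  have Fnorm: "norm (F y) \<le> norm y" for y
  proof (cases "w y = 0")
    case False
    have "norm (w y) * norm (w y) = w y \<bullet> w y" by (simp flip: power2_norm_eq_inner power2_eq_square)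
    also have "\<dots> = f (sc (w y) y)" by (rule w)
    also have "\<dots> \<le> norm (w y) * norm y" using f(2)[of "sc (w y) y"] by (simp add: norm_sc)
    finally have "norm (w y) \<le> norm y" using False by simp
    moreover have "norm (F y) = norm (w y)"
      using False by (simp add: F_def norm_inverse power2_eq_square)
    ultimately show ?thesis by simp
  qed (simp add: F_def)
  have Flin: "bounded_linear F"
  proof (rule bounded_linear_intro[where K = 1])
    show "F (r *\<^sub>R y) = r *\<^sub>R F y" for r y
      using Fsc[of "of_real r" y] by (simp add: sc_of_real scaleR_conv_of_real)
  qed (use Fadd Fnorm in auto)
  then have app: "blinfun_apply (Blinfun F) = F" by (rule bounded_linear_Blinfun_apply)
  have "Vector_Spaces.linear sc (*) F"
    using Fadd Fsc vector_space_axioms vector_space_over_itself.vector_space_axioms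
    by (auto simp: Vector_Spaces.linear_iff)
  then have "Blinfun F \<in> dual_space sc" by (simp add: dual_space_def app)
  moreover have "norm (Blinfun F) \<le> 1" by (rule norm_blinfun_bound) (auto simp: app Fnorm)
  moreover have "norm x \<le> norm (F x)"
  proof -
    have "norm x = F x \<bullet> 1" using F[of 1 x] f(3) by simp
    also have "\<dots> \<le> norm (F x) * norm (1::'k)" by (rule norm_cauchy_schwarz)
    finally show ?thesis by simp
  qed
  ultimately show ?thesis by (auto simp: app)
qed

section \<open>Uniform boundedness\<close>

text \<open>Banach--Steinhaus, by the Baire category theorem applied to the closed sets on which the whole
  sequence is bounded by \<open>k\<close>. Sequences are enough here: a semigroup unbounded near zero is
  unbounded along a sequence tending to zero.\<close>
lemma uniform_boundedness_seq:
  fixes U :: "nat \<Rightarrow> 'a::banach \<Rightarrow>\<^sub>L 'b::real_normed_vector"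
  assumes bd: "\<And>x. bounded (range (\<lambda>n. U n x))"
  shows "bounded (range U)"
proof -
  define A where "A k = {x. \<forall>n. norm (U n x) \<le> real k}" for k
  have cl: "closed (A k)" for k
    unfolding A_def by (intro closed_Collect_all closed_Collect_le continuous_intros)
  have "\<exists>k. x \<in> A k" for x
  proof -
    obtain B where "\<And>n. norm (U n x) \<le> B" using bd[of x] by (auto simp: bounded_iff)
    then show ?thesis using real_arch_simple[of B] by (auto simp: A_def intro: order_trans)
  qed
  then have un: "\<Union> (range A) = UNIV" by auto
  have "\<exists>k. interior (A k) \<noteq> {}"
  proof (rule ccontr)
    assume "\<not> ?thesis"
    then have "euclidean interior_of \<Union> (range A) = {}"
      using cl by (intro Baire_category_alt) (auto simp: completely_metrizable_space_euclidean)
    then show False using un by simp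
  qed
  then obtain k x e where e: "e > 0" "cball x e \<subseteq> A k"
    by (meson equals0I mem_interior_cball ex_in_conv)
  have "norm (U n) \<le> 2 * real k / e" for n
  proof (rule norm_blinfun_bound)
    fix y :: 'a
    show "norm (U n y) \<le> 2 * real k / e * norm y"
    proof (cases "y = 0")
      case False
      define z where "z = (e / norm y) *\<^sub>R y"
      have "norm z = e" using False e by (simp add: z_def)
      then have "x + z \<in> A k" "x \<in> A k" using e by (auto simp: dist_norm subset_eq)
      then have "norm (U n (x + z)) \<le> k" "norm (U n x) \<le> k" by (auto simp: A_def)
      then have "norm (U n z) \<le> 2 * real k"
        using norm_triangle_ineq4[of "U n (x + z)" "U n x"] by (simp add: blinfun.add_right)
      then show ?thesis using False e by (simp add: z_def blinfun.scaleR_right field_simps)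
    qed simp
  qed (use e in auto)
  then show ?thesis by (auto simp: bounded_iff)
qed

section \<open>Semigroups and their continuity\<close>

text \<open>Orbits in \<open>X\<close> and orbits of the adjoint semigroup are continuous for the same reason: the
  increment over \<open>[s, t]\<close> is controlled by the increment over \<open>[0, t - s]\<close>.\<close>
lemma continuous_on_half_line:
  fixes g :: "real \<Rightarrow> 'b::metric_space"
  assumes h: "(h \<longlongrightarrow> (0::real)) (at_right 0)"
    and M: "\<And>b. \<exists>M. \<forall>s t. 0 \<le> s \<and> s < t \<and> t \<le> b \<longrightarrow> dist (g s) (g t) \<le> M * h (t - s)"
  shows "continuous_on {0..} g"
  unfolding continuous_on_iff
proof (intro ballI allI impI)
  fix t e :: real assume t: "t \<in> {0..}" and e: "e > 0"
  obtain M where M: "\<And>r s. 0 \<le> r \<Longrightarrow> r < s \<Longrightarrow> s \<le> t + 1 \<Longrightarrow> dist (g r) (g s) \<le> M * h (s - r)"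
    using M[of "t + 1"] by blast
  have "((\<lambda>r. M * h r) \<longlongrightarrow> M * 0) (at_right 0)" by (intro tendsto_intros h)
  then have "eventually (\<lambda>r. M * h r < e) (at_right 0)"
    using e by (auto dest: order_tendstoD(2))
  then obtain d where d: "d > 0" "\<And>r. 0 < r \<Longrightarrow> r < d \<Longrightarrow> M * h r < e"
    unfolding eventually_at_right_field by auto
  show "\<exists>d>0. \<forall>s\<in>{0..}. dist s t < d \<longrightarrow> dist (g s) (g t) < e"
  proof (intro exI[of _ "min d 1"] conjI ballI impI)
    fix s :: real assume s: "s \<in> {0..}" "dist s t < min d 1"
    consider "s < t" | "s = t" | "t < s" by linarith
    then show "dist (g s) (g t) < e"
    proof cases
      case 1
      then show ?thesis using M[of s t] d(2)[of "t - s"] s by (auto simp: dist_real_def)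
    next
      case 3
      then show ?thesis using M[of t s] d(2)[of "s - t"] s t by (auto simp: dist_real_def dist_commute)
    qed (use e in auto)
  qed (use d in auto)
qed

locale sun_duality = banach_over sc
  for sc :: "'k::{real_normed_field,euclidean_space} \<Rightarrow> 'a::banach \<Rightarrow> 'a" +
  fixes T :: "real \<Rightarrow> 'a \<Rightarrow>\<^sub>L 'a"
  assumes C0: "C0_semigroup sc T"
begin

lemma T_zero: "T 0 = id_blinfun"
  and T_add: "s \<ge> 0 \<Longrightarrow> t \<ge> 0 \<Longrightarrow> T (s + t) = T s o\<^sub>L T t"
  and T_tendsto: "((\<lambda>t. T t x) \<longlongrightarrow> x) (at_right 0)"
  and T_linear: "t \<ge> 0 \<Longrightarrow> Vector_Spaces.linear sc sc (T t)"
  using C0 by (auto simp: C0_semigroup_def)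

lemma T_scale: "t \<ge> 0 \<Longrightarrow> T t (sc c x) = sc c (T t x)"
  using T_linear[of t] by (simp add: Vector_Spaces.linear_iff)

lemma T_add_apply: "s \<ge> 0 \<Longrightarrow> t \<ge> 0 \<Longrightarrow> T s (T t x) = T (s + t) x"
  by (simp add: T_add)

lemma T_bounded_near_zero: "\<exists>d>0. \<exists>M. \<forall>t\<in>{0..d}. norm (T t) \<le> M"
proof (rule ccontr)
  assume *: "\<not> ?thesis"
  have "\<exists>t. 0 < t \<and> t < 1 / real (Suc n) \<and> norm (T t) > real (Suc n)" for n
  proof -
    have "\<exists>t\<in>{0..1 / (2 * real (Suc n))}. norm (T t) > real (Suc n)"
      using * by (auto simp: not_le dest!: spec[of _ "1 / (2 * real (Suc n))"])
    then obtain t where t: "t \<ge> 0" "t \<le> 1 / (2 * real (Suc n))" "norm (T t) > real (Suc n)" by auto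
    have "t \<noteq> 0"
    proof
      assume "t = 0"
      then have "norm (T t) \<le> 1" using norm_blinfun_id_le T_zero by simp
      then show False using t(3) by simp
    qed
    moreover have "1 / (2 * real (Suc n)) < 1 / real (Suc n)" by (simp add: field_simps)
    ultimately show ?thesis using t by (intro exI[of _ t]) auto
  qed
  then obtain r where r: "\<And>n. 0 < r n" "\<And>n. r n < 1 / real (Suc n)" "\<And>n. norm (T (r n)) > real (Suc n)"
    by metis
  have "r \<longlonglongrightarrow> 0"
    by (rule tendsto_sandwich[OF _ _ tendsto_const LIMSEQ_Suc[OF lim_1_over_n]])
       (use r in \<open>auto intro!: always_eventually less_imp_le\<close>)
  then have r0: "filterlim r (at_right 0) sequentially"
    using r(1) by (auto simp: filterlim_at less_imp_neq[symmetric] intro!: always_eventually less_imp_neq[symmetric])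
  have "bounded (range (\<lambda>n. T (r n) x))" for x
    using filterlim_compose[OF T_tendsto r0] by (intro convergent_imp_bounded)
  then have "bounded (range (\<lambda>n. T (r n)))" by (rule uniform_boundedness_seq)
  then obtain B where B: "\<And>n. norm (T (r n)) \<le> B" by (auto simp: bounded_iff)
  obtain n where "B < real n" using reals_Archimedean2 by blast
  then show False using r(3)[of n] B[of n] by simp
qed

lemma T_bounded: "\<exists>M\<ge>1. \<forall>t\<in>{0..b}. norm (T t) \<le> M"
proof -
  obtain d M0 where d: "d > 0" and M0: "\<And>t. t \<in> {0..d} \<Longrightarrow> norm (T t) \<le> M0"
    using T_bounded_near_zero by blast
  define M where "M = max M0 1"
  have M: "norm (T t) \<le> M" if "t \<in> {0..d}" for t using M0[OF that] by (simp add: M_def)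
  have M1: "M \<ge> 1" by (simp add: M_def)
  have *: "norm (T t) \<le> M ^ Suc n" if "t \<in> {0..real (Suc n) * d}" for n t
    using that
  proof (induction n arbitrary: t)
    case (Suc n)
    show ?case
    proof (cases "t \<le> real (Suc n) * d")
      case True
      then have "norm (T t) \<le> M ^ Suc n" using Suc by auto
      also have "\<dots> \<le> M ^ Suc (Suc n)" using M1 by (intro power_increasing) auto
      finally show ?thesis .
    next
      case False
      have "0 \<le> real (Suc n) * d" using d by simp
      have "d \<le> real (Suc n) * d" using d by simp
      then have "d \<le> t" using False by linarith
      then have "t - d \<ge> 0" "t - d \<le> real (Suc n) * d"
        using False Suc.prems d by (auto simp: algebra_simps)
      then have "norm (T (d + (t - d))) \<le> norm (T d) * norm (T (t - d))"
        using d norm_blinfun_compose by (subst T_add) auto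
      also have "\<dots> \<le> M * M ^ Suc n"
        using M[of d] d Suc.IH[of "t - d"] \<open>t - d \<ge> 0\<close> \<open>t - d \<le> real (Suc n) * d\<close> M1
        by (intro mult_mono) auto
      finally show ?thesis by simp
    qed
  qed (use M in auto)
  obtain n where "b / d < real n" using reals_Archimedean2 by blast
  then have "b \<le> real (Suc n) * d" using d by (simp add: field_simps)
  then have "norm (T t) \<le> M ^ Suc n" if "t \<in> {0..b}" for t using that by (intro *) auto
  moreover have "M ^ Suc n \<ge> 1" using M1 by (rule one_le_power)
  ultimately show ?thesis by blast
qed

lemma T_continuous: "continuous_on {0..} (\<lambda>t. T t x)"
proof (rule continuous_on_half_line)
  show "((\<lambda>t. norm (T t x - x)) \<longlongrightarrow> 0) (at_right 0)"
    using tendsto_norm_zero[OF LIM_zero[OF T_tendsto]] .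
  fix b
  obtain M where M: "\<And>t. t \<in> {0..b} \<Longrightarrow> norm (T t) \<le> M" using T_bounded by blast
  have "dist (T s x) (T t x) \<le> M * norm (T (t - s) x - x)" if "0 \<le> s" "s < t" "t \<le> b" for s t
  proof -
    have "T t x - T s x = T s (T (t - s) x - x)"
      using that by (simp add: blinfun.diff_right T_add_apply)
    also have "norm \<dots> \<le> norm (T s) * norm (T (t - s) x - x)" by (rule norm_blinfun)
    also have "\<dots> \<le> M * norm (T (t - s) x - x)" using M that by (intro mult_right_mono) auto
    finally show ?thesis by (simp add: dist_norm norm_minus_commute)
  qed
  then show "\<exists>M. \<forall>s t. 0 \<le> s \<and> s < t \<and> t \<le> b \<longrightarrow> dist (T s x) (T t x) \<le> M * norm (T (t - s) x - x)"
    by blast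
qed

section \<open>The sun dual is invariant and norming\<close>

abbreviation "X_sun \<equiv> sun_dual sc T"

lemma dual_space_iff: "x' \<in> dual_space sc \<longleftrightarrow> (\<forall>c x. blinfun_apply x' (sc c x) = c * x' x)"
  using vector_space_axioms vector_space_over_itself.vector_space_axioms
  by (auto simp: dual_space_def Vector_Spaces.linear_iff blinfun.add_right)

lemma sun_in_dual: "x' \<in> X_sun \<Longrightarrow> x' \<in> dual_space sc"
  and sun_tendsto: "x' \<in> X_sun \<Longrightarrow> ((\<lambda>t. norm ((x' o\<^sub>L T t) - x')) \<longlongrightarrow> 0) (at_right 0)"
  by (auto simp: sun_dual_def)

lemma sun_dualI:
  assumes "x' \<in> dual_space sc" "d > 0"
    and "\<And>t. 0 < t \<Longrightarrow> t < d \<Longrightarrow> norm ((x' o\<^sub>L T t) - x') \<le> g t"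
    and g: "(g \<longlongrightarrow> 0) (at_right 0)"
  shows "x' \<in> X_sun"
proof -
  have "eventually (\<lambda>t. norm ((x' o\<^sub>L T t) - x') \<le> g t) (at_right 0)"
    unfolding eventually_at_right_field using assms by blast
  then have "((\<lambda>t. norm ((x' o\<^sub>L T t) - x')) \<longlongrightarrow> 0) (at_right 0)"
    by (rule tendsto_sandwich[OF always_eventually _ tendsto_const g, rotated]) auto
  then show ?thesis using assms by (simp add: sun_dual_def)
qed

lemma zero_in_sun: "0 \<in> X_sun"
  by (auto simp: sun_dual_def dual_space_iff bounded_bilinear.zero_left[OF bounded_bilinear_blinfun_compose])

lemma sun_add: "x' + y' \<in> X_sun" if "x' \<in> X_sun" "y' \<in> X_sun"
proof (rule sun_dualI[where d = 1])
  show "norm (((x' + y') o\<^sub>L T t) - (x' + y')) \<le> norm ((x' o\<^sub>L T t) - x') + norm ((y' o\<^sub>L T t) - y')" for t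
    by (rule order_trans[OF eq_refl norm_triangle_ineq])
       (simp add: bounded_bilinear.add_left[OF bounded_bilinear_blinfun_compose] algebra_simps)
  show "((\<lambda>t. norm ((x' o\<^sub>L T t) - x') + norm ((y' o\<^sub>L T t) - y')) \<longlongrightarrow> 0) (at_right 0)"
    using tendsto_add[OF sun_tendsto sun_tendsto, OF that] by simp
  show "x' + y' \<in> dual_space sc"
    using that[THEN sun_in_dual] by (auto simp: dual_space_iff blinfun.add_left algebra_simps)
qed simp

lemma norm_mult_right_compose: "norm (blinfun_mult_right c o\<^sub>L x') \<le> norm c * norm x'"
  for c :: 'k and x' :: "'a \<Rightarrow>\<^sub>L 'k"
proof (rule norm_blinfun_bound)
  fix x
  have "norm c * norm (x' x) \<le> norm c * (norm x' * norm x)"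
    by (intro mult_left_mono norm_blinfun) auto
  then show "norm ((blinfun_mult_right c o\<^sub>L x') x) \<le> norm c * norm x' * norm x"
    by (simp add: norm_mult mult.assoc)
qed simp

lemma sun_scale: "blinfun_mult_right c o\<^sub>L x' \<in> X_sun" if "x' \<in> X_sun"
proof (rule sun_dualI[where d = 1])
  show "norm (((blinfun_mult_right c o\<^sub>L x') o\<^sub>L T t) - (blinfun_mult_right c o\<^sub>L x'))
      \<le> norm c * norm ((x' o\<^sub>L T t) - x')" for t
    by (rule order_trans[OF eq_refl norm_mult_right_compose], rule arg_cong[of _ _ norm], rule blinfun_eqI)
       (simp add: blinfun.diff_left algebra_simps)
  show "((\<lambda>t. norm c * norm ((x' o\<^sub>L T t) - x')) \<longlongrightarrow> 0) (at_right 0)"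
    using tendsto_mult_right_zero[OF sun_tendsto[OF that]] .
  show "blinfun_mult_right c o\<^sub>L x' \<in> dual_space sc"
    using that[THEN sun_in_dual] by (auto simp: dual_space_iff algebra_simps)
qed simp

lemma minus_conv_scale: "- x' = blinfun_mult_right (- 1) o\<^sub>L x'" for x' :: "'a \<Rightarrow>\<^sub>L 'k"
  by (rule blinfun_eqI) (simp add: blinfun.minus_left)

lemma sun_diff: "x' \<in> X_sun \<Longrightarrow> y' \<in> X_sun \<Longrightarrow> x' - y' \<in> X_sun"
  using sun_add[of x' "- y'"] sun_scale[of y' "- 1"] by (simp flip: minus_conv_scale)

lemma sun_compose: "x' o\<^sub>L T t \<in> X_sun" if "x' \<in> X_sun" "t \<ge> 0"
proof (rule sun_dualI[where d = 1])
  show "norm (((x' o\<^sub>L T t) o\<^sub>L T s) - (x' o\<^sub>L T t)) \<le> norm ((x' o\<^sub>L T s) - x') * norm (T t)"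
    if "0 < s" for s
  proof (rule order_trans[OF eq_refl norm_blinfun_compose], rule arg_cong[of _ _ norm], rule blinfun_eqI)
    show "((x' o\<^sub>L T t o\<^sub>L T s) - (x' o\<^sub>L T t)) x = ((x' o\<^sub>L T s) - x' o\<^sub>L T t) x" for x
      using that \<open>t \<ge> 0\<close> by (simp add: blinfun.diff_left T_add_apply add.commute)
  qed
  show "((\<lambda>s. norm ((x' o\<^sub>L T s) - x') * norm (T t)) \<longlongrightarrow> 0) (at_right 0)"
    using tendsto_mult_left_zero[OF sun_tendsto[OF that(1)]] .
  show "x' o\<^sub>L T t \<in> dual_space sc"
    using that(1)[THEN sun_in_dual] T_scale[OF that(2)] by (auto simp: dual_space_iff)
qed simp

lemma sun_orbit_continuous: "continuous_on {0..} (\<lambda>t. x' o\<^sub>L T t)" if "x' \<in> X_sun"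
proof (rule continuous_on_half_line[OF sun_tendsto[OF that]])
  fix b
  obtain M where M: "\<And>t. t \<in> {0..b} \<Longrightarrow> norm (T t) \<le> M" using T_bounded by blast
  have "dist (x' o\<^sub>L T s) (x' o\<^sub>L T t) \<le> M * norm ((x' o\<^sub>L T (t - s)) - x')" if "0 \<le> s" "s < t" "t \<le> b" for s t
  proof -
    have "(x' o\<^sub>L T t) - (x' o\<^sub>L T s) = ((x' o\<^sub>L T (t - s)) - x') o\<^sub>L T s"
      using that by (intro blinfun_eqI) (simp add: blinfun.diff_left T_add_apply)
    also have "norm \<dots> \<le> norm ((x' o\<^sub>L T (t - s)) - x') * norm (T s)" by (rule norm_blinfun_compose)
    also have "\<dots> \<le> norm ((x' o\<^sub>L T (t - s)) - x') * M" using M that by (intro mult_left_mono) auto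
    finally show ?thesis by (simp add: dist_norm norm_minus_commute mult.commute)
  qed
  then show "\<exists>M. \<forall>s t. 0 \<le> s \<and> s < t \<and> t \<le> b \<longrightarrow>
      dist (x' o\<^sub>L T s) (x' o\<^sub>L T t) \<le> M * norm ((x' o\<^sub>L T (t - s)) - x')"
    by blast
qed

lemma orbit_functional_continuous: "continuous_on {0..} (\<lambda>s. blinfun_apply x' (T s x))"
  by (intro continuous_intros T_continuous)

lemma orbit_functional_integrable: "0 \<le> a \<Longrightarrow> (\<lambda>s. blinfun_apply x' (T s x)) integrable_on {a..b}"
  for x' :: "'a \<Rightarrow>\<^sub>L 'k"
  by (intro integrable_continuous_real continuous_on_subset[OF orbit_functional_continuous]) auto

text \<open>The weak-star average of an adjoint orbit over \<open>[0, h]\<close> lies in the sun dual: translating it by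
  \<open>t\<close> changes it only through two end pieces of length \<open>t\<close>.\<close>
lemma exists_mean_functional:
  assumes x': "x' \<in> dual_space sc" and h: "0 < h" "h \<le> 1"
    and M: "\<And>t. t \<in> {0..2} \<Longrightarrow> norm (T t) \<le> M"
  shows "\<exists>m\<in>X_sun. norm m \<le> M * norm x' \<and>
    (\<forall>x. blinfun_apply m x = (1 / h) *\<^sub>R integral {0..h} (\<lambda>s. x' (T s x)))"
proof -
  define I where "I a b x = integral {a..b} (\<lambda>s. x' (T s x))" for a b x
  have bnd: "norm (I a b x) \<le> norm x' * M * norm x * (b - a)" if "0 \<le> a" "a \<le> b" "b \<le> 2" for a b x
    unfolding I_def
  proof (rule integral_bound)
    show "continuous_on {a..b} (\<lambda>s. x' (T s x))"
      by (rule continuous_on_subset[OF orbit_functional_continuous]) (use that in auto)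
    fix s assume s: "s \<in> {a..b}"
    have "norm (x' (T s x)) \<le> norm x' * norm (T s x)" by (rule norm_blinfun)
    also have "\<dots> \<le> norm x' * (norm (T s) * norm x)" by (intro mult_left_mono norm_blinfun) auto
    also have "\<dots> \<le> norm x' * (M * norm x)"
      using M s that by (intro mult_left_mono mult_right_mono) auto
    finally show "norm (x' (T s x)) \<le> norm x' * M * norm x" by (simp add: mult.assoc)
  qed (use that in auto)
  have Isc: "I a b (sc c x) = c * I a b x" if "0 \<le> a" for a b c x
  proof -
    have "I a b (sc c x) = integral {a..b} (\<lambda>s. c * x' (T s x))"
      unfolding I_def using x' that by (intro integral_cong) (auto simp: T_scale dual_space_iff)
    then show ?thesis by (simp add: I_def)
  qed
  have Iadd: "I a b (x + y) = I a b x + I a b y" if "0 \<le> a" for a b x y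
    unfolding I_def blinfun.add_right by (intro integral_add orbit_functional_integrable that)
  define f where "f x = (1 / h) *\<^sub>R I 0 h x" for x
  have fnorm: "norm (f x) \<le> norm x * (norm x' * M)" for x
    using bnd[of 0 h x] h by (simp add: f_def field_simps)
  have "bounded_linear f"
  proof (rule bounded_linear_intro)
    show "f (r *\<^sub>R x) = r *\<^sub>R f x" for r x
      using Isc[of 0 h "of_real r" x] by (simp add: f_def sc_of_real scaleR_conv_of_real)
  qed (use fnorm Iadd in \<open>auto simp: f_def scaleR_right_distrib\<close>)
  then have app: "blinfun_apply (Blinfun f) = f" by (rule bounded_linear_Blinfun_apply)
  have "0 \<le> M" using order_trans[OF norm_ge_zero M[of 0]] by simp
  then have nm: "norm (Blinfun f) \<le> M * norm x'"
    using fnorm by (intro norm_blinfun_bound) (auto simp: app mult_ac)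
  have "Blinfun f \<in> X_sun"
  proof (rule sun_dualI[where d = h])
    show "Blinfun f \<in> dual_space sc" using Isc by (auto simp: dual_space_iff app f_def scaleR_conv_of_real)
    fix t :: real assume t: "0 < t" "t < h"
    show "norm ((Blinfun f o\<^sub>L T t) - Blinfun f) \<le> (2 * (norm x' * M) / h) * t"
    proof (rule norm_blinfun_bound)
      fix x
      have "I 0 h (T t x) = integral {0..h} ((\<lambda>s. x' (T s x)) \<circ> (+) t)"
        unfolding I_def using t by (intro integral_cong) (auto simp: T_add_apply add.commute)
      also have "\<dots> = I t (t + h) x"
        unfolding I_def by (simp only: integral_shift_Icc_real) (simp add: add.commute)
      finally have "I 0 h (T t x) = I t h x + I h (t + h) x"
        using t h unfolding I_def
        by (subst Henstock_Kurzweil_Integration.integral_combine) (auto intro!: orbit_functional_integrable)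
      moreover have "I 0 h x = I 0 t x + I t h x"
        using t h unfolding I_def
        by (subst Henstock_Kurzweil_Integration.integral_combine) (auto intro!: orbit_functional_integrable)
      ultimately have eq: "I 0 h (T t x) - I 0 h x = I h (t + h) x - I 0 t x" by simp
      have "norm (I h (t + h) x - I 0 t x) \<le> norm x' * M * norm x * t + norm x' * M * norm x * t"
        using bnd[of h "t + h" x] bnd[of 0 t x] t h by (intro norm_triangle_le_diff add_mono) auto
      then have "norm (f (T t x) - f x) \<le> (1 / h) * (2 * (norm x' * M * norm x * t))"
        using h unfolding f_def eq scaleR_diff_right[symmetric] norm_scaleR
        by (intro mult_mono) (auto simp: mult_ac)
      then show "norm (((Blinfun f o\<^sub>L T t) - Blinfun f) x) \<le> 2 * (norm x' * M) / h * t * norm x"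
        by (simp add: app blinfun.diff_left field_simps)
    qed (use \<open>0 \<le> M\<close> t in auto)
  next
    have "((\<lambda>t. 2 * (norm x' * M) / h * t) \<longlongrightarrow> 2 * (norm x' * M) / h * 0) (at_right 0)"
      by (intro tendsto_intros)
    then show "((\<lambda>t. 2 * (norm x' * M) / h * t) \<longlongrightarrow> 0) (at_right 0)" by simp
  qed (use h in auto)
  then show ?thesis using nm by (intro bexI[of _ "Blinfun f"]) (auto simp: app f_def I_def)
qed

text \<open>The embedding \<open>j\<close> is bounded below. A norming functional for \<open>x\<close> need not lie in the sun dual, but
  its averages do; their norms exceed that of the functional at most by the factor \<open>M\<close>, a bound of
  the semigroup on \<open>[0, 2]\<close>, and their values at \<open>x\<close> converge to its value. The modulus of \<open>B\<close> spares the user a separate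
  proof that \<open>B\<close> is nonnegative.\<close>
lemma sun_dual_norming:
  "\<exists>M\<ge>1. \<forall>x B. (\<forall>x'\<in>X_sun. norm (blinfun_apply x' x) \<le> B * norm x') \<longrightarrow> norm x \<le> M * \<bar>B\<bar>"
proof -
  obtain M where M: "M \<ge> 1" "\<And>t. t \<in> {0..2} \<Longrightarrow> norm (T t) \<le> M" using T_bounded by blast
  have "norm x \<le> M * \<bar>B\<bar>" if B: "\<And>x'. x' \<in> X_sun \<Longrightarrow> norm (blinfun_apply x' x) \<le> B * norm x'" for x B
  proof -
    obtain x' where x': "x' \<in> dual_space sc" "norm x' \<le> 1" "norm x \<le> norm (blinfun_apply x' x)"
      using banach_over_norming_functional[OF banach_over_axioms] by blast
    define g where "g s = blinfun_apply x' (T s x)" for s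
    define m where "m h = (1 / h) *\<^sub>R integral {0..h} g" for h
    have m_le: "norm (m h) \<le> M * \<bar>B\<bar>" if h: "0 < h" "h \<le> 1" for h
    proof -
      obtain y' where y': "y' \<in> X_sun" "norm y' \<le> M * norm x'" "y' x = m h"
        using exists_mean_functional[OF x'(1) h M(2)] unfolding m_def g_def by auto
      have "norm (m h) \<le> B * norm y'" using B[OF y'(1)] y'(3) by simp
      also have "\<dots> \<le> \<bar>B\<bar> * (M * 1)"
        using y'(2) x'(2) M(1) by (intro mult_mono) (auto intro: order_trans)
      finally show ?thesis by (simp add: mult.commute)
    qed
    have cont: "continuous_on {0..} g"
      unfolding g_def by (rule orbit_functional_continuous)
    have "norm (g 0) \<le> M * \<bar>B\<bar> + e" if e: "e > 0" for e
    proof -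
      obtain d where d: "d > 0" "\<And>s. 0 \<le> s \<Longrightarrow> s < d \<Longrightarrow> norm (g s - g 0) < e"
        using cont e by (force simp: continuous_on_iff dist_norm)
      define h where "h = min 1 (d / 2)"
      have h: "0 < h" "h \<le> 1" "h < d" using d by (auto simp: h_def)
      have cont_h: "continuous_on {0..h} g" by (rule continuous_on_subset[OF cont]) auto
      have "norm (integral {0..h} (\<lambda>s. g s - g 0)) \<le> e * (h - 0)"
        using h d by (intro integral_bound continuous_intros cont_h) (auto intro: less_imp_le)
      also have "integral {0..h} (\<lambda>s. g s - g 0) = h *\<^sub>R (m h - g 0)"
        using h integrable_continuous_real[OF cont_h]
          by (subst Henstock_Kurzweil_Integration.integral_diff) (auto simp: m_def scaleR_diff_right)
      finally have "norm (m h - g 0) \<le> e" using h by simp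
      then show ?thesis using m_le[of h] h norm_triangle_sub[of "g 0" "m h"] by (simp add: norm_minus_commute)
    qed
    then have "norm (g 0) \<le> M * \<bar>B\<bar>" by (rule field_le_epsilon)
    then show ?thesis using x'(3) by (simp add: g_def T_zero)
  qed
  then show ?thesis using M(1) by blast
qed

end

section \<open>Norm-continuous functions into the dual of the sun dual\<close>

context sun_duality
begin

abbreviation "X_sun_star \<equiv> sun_star sc T"
abbreviation "j \<equiv> sun_emb sc T"
abbreviation "conv \<equiv> sun_star_convolution sc T"

lemma sun_star_additive: "F \<in> X_sun_star \<Longrightarrow> x' \<in> X_sun \<Longrightarrow> y' \<in> X_sun \<Longrightarrow> F (x' + y') = F x' + F y'"
  and sun_star_homogeneous: "F \<in> X_sun_star \<Longrightarrow> x' \<in> X_sun \<Longrightarrow> F (blinfun_mult_right c o\<^sub>L x') = c * F x'"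
  by (auto simp: sun_star_def)

lemma sun_star_diff_arg:
  "F (x' - y') = F x' - F y'" if "F \<in> X_sun_star" "x' \<in> X_sun" "y' \<in> X_sun"
  using sun_star_additive[OF that(1), of "x' - y'" y'] that sun_diff by simp

lemma sun_star_zero_arg: "F \<in> X_sun_star \<Longrightarrow> F 0 = 0"
  using sun_star_diff_arg[OF _ zero_in_sun zero_in_sun] by simp

lemma sun_star_bounded: "\<exists>K\<ge>0. \<forall>x'\<in>X_sun. norm (F x') \<le> K * norm x'" if F: "F \<in> X_sun_star"
proof -
  obtain K where K: "\<forall>x'\<in>X_sun. norm (F x') \<le> K * norm x'"
    using F by (auto simp: sun_star_def)
  have "norm (F x') \<le> \<bar>K\<bar> * norm x'" if "x' \<in> X_sun" for x'
    using K that mult_right_mono[of K "\<bar>K\<bar>" "norm x'"] by force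
  then show ?thesis by (intro exI[of _ "\<bar>K\<bar>"]) auto
qed

lemma sun_star_diff: "F - G \<in> X_sun_star" if FG: "F \<in> X_sun_star" "G \<in> X_sun_star"
proof -
  obtain K K' where K: "\<forall>x'\<in>X_sun. norm (F x') \<le> K * norm x'" "\<forall>x'\<in>X_sun. norm (G x') \<le> K' * norm x'"
    using FG[THEN sun_star_bounded] by blast
  have "norm (F x' - G x') \<le> (K + K') * norm x'" if "x' \<in> X_sun" for x'
    unfolding distrib_right by (rule order_trans[OF norm_triangle_ineq4 add_mono]) (use K that in auto)
  then have "\<exists>K. \<forall>x'\<in>X_sun. norm (F x' - G x') \<le> K * norm x'" by blast
  then show ?thesis using FG by (auto simp: sun_star_def algebra_simps)
qed

lemma sun_star_add: "F + G \<in> X_sun_star" if FG: "F \<in> X_sun_star" "G \<in> X_sun_star"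
proof -
  obtain K K' where K: "\<forall>x'\<in>X_sun. norm (F x') \<le> K * norm x'" "\<forall>x'\<in>X_sun. norm (G x') \<le> K' * norm x'"
    using FG[THEN sun_star_bounded] by blast
  have "norm (F x' + G x') \<le> (K + K') * norm x'" if "x' \<in> X_sun" for x'
    unfolding distrib_right by (rule norm_triangle_mono) (use K that in auto)
  then have "\<exists>K. \<forall>x'\<in>X_sun. norm (F x' + G x') \<le> K * norm x'" by blast
  then show ?thesis using FG by (auto simp: sun_star_def algebra_simps)
qed

text \<open>A supremum of reals is meaningful only for bounded sets, so this fact and all that follow from
  it rest on the boundedness of members of the dual of the sun dual.\<close>
lemma sun_star_norm_upper:
  "norm (F x') \<le> sun_star_norm sc T F" if F: "F \<in> X_sun_star" and x': "x' \<in> X_sun" "norm x' \<le> 1"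
  unfolding sun_star_norm_def
proof (rule cSUP_upper)
  obtain K where K: "K \<ge> 0" "\<forall>x'\<in>X_sun. norm (F x') \<le> K * norm x'"
    using sun_star_bounded[OF F] by blast
  have "norm (F y') \<le> K" if "y' \<in> X_sun" "norm y' \<le> 1" for y'
    using K(2) that mult_left_mono[OF that(2) K(1)] by force
  then show "bdd_above ((\<lambda>y'. norm (F y')) ` {y' \<in> X_sun. norm y' \<le> 1})"
    by (auto simp: bdd_above_def)
qed (use x' in simp)

lemma sun_star_norm_nonneg: "F \<in> X_sun_star \<Longrightarrow> 0 \<le> sun_star_norm sc T F"
  using sun_star_norm_upper[OF _ zero_in_sun] by (simp add: sun_star_zero_arg)

lemma sun_star_le_norm:
  "norm (F x') \<le> sun_star_norm sc T F * norm x'" if F: "F \<in> X_sun_star" and x': "x' \<in> X_sun"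
proof (cases "x' = 0")
  case False
  define y' where "y' = blinfun_mult_right (of_real (1 / norm x')) o\<^sub>L x'"
  have "norm y' \<le> norm (of_real (1 / norm x') :: 'k) * norm x'"
    unfolding y'_def by (rule norm_mult_right_compose)
  then have "norm y' \<le> 1" using False by (simp add: norm_divide)
  then have "norm (F y') \<le> sun_star_norm sc T F"
    by (intro sun_star_norm_upper F) (auto simp: y'_def sun_scale x')
  then show ?thesis
    using False by (simp add: y'_def sun_star_homogeneous[OF F x'] norm_mult norm_divide field_simps)
qed (use F in \<open>simp add: sun_star_zero_arg\<close>)

lemma sun_star_norm_le:
  "sun_star_norm sc T F \<le> B" if "0 \<le> B" "\<And>x'. x' \<in> X_sun \<Longrightarrow> norm (F x') \<le> B * norm x'"
  unfolding sun_star_norm_def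
proof (rule cSUP_least)
  show "{x' \<in> X_sun. norm x' \<le> 1} \<noteq> {}" using zero_in_sun by auto
  fix x' assume "x' \<in> {x' \<in> X_sun. norm x' \<le> 1}"
  then show "norm (F x') \<le> B"
    using that(2)[of x'] mult_left_mono[of "norm x'" 1 B] that(1) by auto
qed

text \<open>Norm continuity in terms of pairings with the sun dual. In this form no supremum has to be
  manipulated.\<close>
lemma norm_continuous_on_iff:
  assumes f: "f ` J \<subseteq> X_sun_star"
  shows "norm_continuous_on sc T J f \<longleftrightarrow>
    (\<forall>t\<in>J. \<forall>e>0. \<exists>d>0. \<forall>s\<in>J. \<bar>s - t\<bar> < d \<longrightarrow>
       (\<forall>x'\<in>X_sun. norm (f s x' - f t x') \<le> e * norm x'))"
    (is "_ \<longleftrightarrow> ?rhs")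
proof
  assume *: "norm_continuous_on sc T J f"
  show ?rhs
  proof (intro ballI allI impI)
    fix t e :: real assume t: "t \<in> J" and e: "e > 0"
    then have "((\<lambda>s. sun_star_norm sc T (f s - f t)) \<longlongrightarrow> 0) (at t within J)"
      using * by (simp add: norm_continuous_on_def)
    then have "eventually (\<lambda>s. sun_star_norm sc T (f s - f t) < e) (at t within J)"
      by (rule order_tendstoD(2)) fact
    then obtain d where d: "d > 0" "\<And>s. s \<in> J \<Longrightarrow> s \<noteq> t \<Longrightarrow> \<bar>s - t\<bar> < d \<Longrightarrow> sun_star_norm sc T (f s - f t) < e"
      by (auto simp: eventually_at dist_real_def)
    have "norm (f s x' - f t x') \<le> e * norm x'" if s: "s \<in> J" "\<bar>s - t\<bar> < d" and x': "x' \<in> X_sun" for s x'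
    proof (cases "s = t")
      case False
      have "norm ((f s - f t) x') \<le> sun_star_norm sc T (f s - f t) * norm x'"
        by (rule sun_star_le_norm[OF sun_star_diff x']) (use f s t in auto)
      also have "\<dots> \<le> e * norm x'" using d(2)[OF s(1) False s(2)] by (intro mult_right_mono) auto
      finally show ?thesis by simp
    qed (use e in simp)
    then show "\<exists>d>0. \<forall>s\<in>J. \<bar>s - t\<bar> < d \<longrightarrow> (\<forall>x'\<in>X_sun. norm (f s x' - f t x') \<le> e * norm x')"
      using d(1) by blast
  qed
next
  assume *: ?rhs
  show "norm_continuous_on sc T J f"
    unfolding norm_continuous_on_def
  proof (intro ballI tendstoI)
    fix t e :: real assume t: "t \<in> J" and e: "e > 0"
    obtain d where d: "d > 0" "\<And>s x'. s \<in> J \<Longrightarrow> \<bar>s - t\<bar> < d \<Longrightarrow> x' \<in> X_sun \<Longrightarrow>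
        norm (f s x' - f t x') \<le> (e / 2) * norm x'"
      using *[rule_format, OF t, of "e / 2"] e by auto
    have "dist (sun_star_norm sc T (f s - f t)) 0 < e" if s: "s \<in> J" "\<bar>s - t\<bar> < d" for s
    proof -
      have "sun_star_norm sc T (f s - f t) \<le> e / 2" using e d(2) s by (intro sun_star_norm_le) auto
      moreover have "0 \<le> sun_star_norm sc T (f s - f t)"
        using f s t by (intro sun_star_norm_nonneg sun_star_diff) auto
      ultimately show ?thesis using e by (simp add: dist_real_def)
    qed
    then show "eventually (\<lambda>s. dist (sun_star_norm sc T (f s - f t)) 0 < e) (at t within J)"
      using d(1) by (auto simp: eventually_at dist_real_def)
  qed
qed

lemma norm_continuous_on_subset:
  "norm_continuous_on sc T J f \<Longrightarrow> K \<subseteq> J \<Longrightarrow> norm_continuous_on sc T K f"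
  unfolding norm_continuous_on_def by (meson subsetD tendsto_within_subset)

lemma norm_continuous_on_compose:
  assumes "norm_continuous_on sc T J f" "f ` J \<subseteq> X_sun_star" "continuous_on K g" "g ` K \<subseteq> J"
  shows "norm_continuous_on sc T K (\<lambda>t. f (g t))"
proof -
  have "\<exists>d>0. \<forall>s\<in>K. \<bar>s - t\<bar> < d \<longrightarrow> (\<forall>x'\<in>X_sun. norm (f (g s) x' - f (g t) x') \<le> e * norm x')"
    if t: "t \<in> K" and e: "e > 0" for t and e :: real
  proof -
    obtain d where d: "d > 0" "\<And>s. s \<in> J \<Longrightarrow> \<bar>s - g t\<bar> < d \<Longrightarrow>
        (\<forall>x'\<in>X_sun. norm (f s x' - f (g t) x') \<le> e * norm x')"
      using assms(1,4) t e unfolding norm_continuous_on_iff[OF assms(2)] by fast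
    obtain d' where d': "d' > 0" "\<And>s. s \<in> K \<Longrightarrow> dist s t < d' \<Longrightarrow> dist (g s) (g t) < d"
      using assms(3) t d(1) unfolding continuous_on_iff by meson
    have "\<forall>x'\<in>X_sun. norm (f (g s) x' - f (g t) x') \<le> e * norm x'" if "s \<in> K" "\<bar>s - t\<bar> < d'" for s
      using d'(2)[of s] that assms(4) by (intro d(2)) (auto simp: dist_real_def)
    then show ?thesis using d'(1) by blast
  qed
  moreover have "(\<lambda>t. f (g t)) ` K \<subseteq> X_sun_star" using assms by auto
  ultimately show ?thesis by (simp add: norm_continuous_on_iff)
qed

lemma norm_continuous_on_add:
  assumes "norm_continuous_on sc T J f" "f ` J \<subseteq> X_sun_star"
    and "norm_continuous_on sc T J g" "g ` J \<subseteq> X_sun_star"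
  shows "norm_continuous_on sc T J (\<lambda>t. f t + g t)"
proof -
  have "\<exists>d>0. \<forall>s\<in>J. \<bar>s - t\<bar> < d \<longrightarrow> (\<forall>x'\<in>X_sun. norm ((f s + g s) x' - (f t + g t) x') \<le> e * norm x')"
    if t: "t \<in> J" and e: "e > 0" for t and e :: real
  proof -
    have e2: "e / 2 > 0" using e by simp
    obtain d where d: "d > 0" "\<And>s x'. s \<in> J \<Longrightarrow> \<bar>s - t\<bar> < d \<Longrightarrow> x' \<in> X_sun \<Longrightarrow>
        norm (f s x' - f t x') \<le> e / 2 * norm x'"
      using assms(1) t e2 unfolding norm_continuous_on_iff[OF assms(2)] by meson
    obtain d' where d': "d' > 0" "\<And>s x'. s \<in> J \<Longrightarrow> \<bar>s - t\<bar> < d' \<Longrightarrow> x' \<in> X_sun \<Longrightarrow>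
        norm (g s x' - g t x') \<le> e / 2 * norm x'"
      using assms(3) t e2 unfolding norm_continuous_on_iff[OF assms(4)] by meson
    have "norm ((f s + g s) x' - (f t + g t) x') \<le> e * norm x'"
      if "s \<in> J" "\<bar>s - t\<bar> < min d d'" "x' \<in> X_sun" for s x'
    proof -
      have "norm ((f s x' - f t x') + (g s x' - g t x')) \<le> e / 2 * norm x' + e / 2 * norm x'"
        using that by (intro norm_triangle_mono d(2) d'(2)) auto
      then show ?thesis by (simp add: algebra_simps)
    qed
    then show ?thesis using d(1) d'(1) by (intro exI[of _ "min d d'"]) auto
  qed
  moreover have "(\<lambda>t. f t + g t) ` J \<subseteq> X_sun_star" using assms by (auto intro: sun_star_add)
  ultimately show ?thesis by (simp add: norm_continuous_on_iff)
qed

lemma norm_continuous_on_bounded: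
  assumes f: "norm_continuous_on sc T {s..t} f" "f ` {s..t} \<subseteq> X_sun_star"
  shows "\<exists>B\<ge>0. \<forall>\<tau>\<in>{s..t}. \<forall>x'\<in>X_sun. norm (f \<tau> x') \<le> B * norm x'"
proof -
  define N where "N \<tau> = sun_star_norm sc T (f \<tau>)" for \<tau>
  have N: "norm (f r x') \<le> N r * norm x'" "0 \<le> N r" if "r \<in> {s..t}" "x' \<in> X_sun" for r x'
  proof -
    have "f r \<in> X_sun_star" using f(2) that by blast
    then show "norm (f r x') \<le> N r * norm x'" "0 \<le> N r"
      using that by (auto simp: N_def intro: sun_star_le_norm sun_star_norm_nonneg)
  qed
  have "continuous_on {s..t} N"
    unfolding continuous_on_iff
  proof (intro ballI allI impI)
    fix r e :: real assume r: "r \<in> {s..t}" and e: "e > 0"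
    then obtain d where d: "d > 0" "\<And>q x'. q \<in> {s..t} \<Longrightarrow> \<bar>q - r\<bar> < d \<Longrightarrow> x' \<in> X_sun \<Longrightarrow>
        norm (f q x' - f r x') \<le> (e / 2) * norm x'"
      using f(1) unfolding norm_continuous_on_iff[OF f(2)] by (meson half_gt_zero)
    have "dist (N q) (N r) < e" if q: "q \<in> {s..t}" "dist q r < d" for q
    proof -
      have *: "norm (f q x' - f r x') \<le> (e / 2) * norm x'" if "x' \<in> X_sun" for x'
        using d(2)[of q x'] q that by (simp add: dist_real_def)
      have "norm (f q x') \<le> (N r + e / 2) * norm x'" if "x' \<in> X_sun" for x'
        using *[OF that] N(1)[OF r that] norm_triangle_sub[of "f q x'" "f r x'"] by (simp add: distrib_right)
      moreover have "norm (f r x') \<le> (N q + e / 2) * norm x'" if "x' \<in> X_sun" for x'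
        using *[OF that] N(1)[OF q(1) that] norm_triangle_sub[of "f r x'" "f q x'"]
        by (simp add: distrib_right norm_minus_commute)
      ultimately have "N q \<le> N r + e / 2" "N r \<le> N q + e / 2"
        using N(2)[OF r zero_in_sun] N(2)[OF q(1) zero_in_sun] e
          sun_star_norm_le[of "N r + e / 2" "f q"] sun_star_norm_le[of "N q + e / 2" "f r"]
        by (auto simp flip: N_def)
      then show ?thesis using e by (simp add: dist_real_def)
    qed
    then show "\<exists>d>0. \<forall>q\<in>{s..t}. dist q r < d \<longrightarrow> dist (N q) (N r) < e" using d(1) by blast
  qed
  then have "bounded (N ` {s..t})" by (intro compact_imp_bounded compact_continuous_image) auto
  then obtain B where B: "\<forall>x\<in>N ` {s..t}. norm x \<le> B" by (auto simp: bounded_iff)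
  have "norm (f r x') \<le> max B 0 * norm x'" if "r \<in> {s..t}" "x' \<in> X_sun" for r x'
  proof -
    have "N r \<le> max B 0" using B that(1) by (force intro: le_max_iff_disj[THEN iffD2])
    then show ?thesis by (rule order_trans[OF N(1)[OF that] mult_right_mono]) simp
  qed
  then show ?thesis by (intro exI[of _ "max B 0"]) auto
qed

lemma pairing_continuous:
  assumes f: "norm_continuous_on sc T J f" "f ` J \<subseteq> X_sun_star"
    and g: "continuous_on J g" "g ` J \<subseteq> X_sun"
  shows "continuous_on J (\<lambda>t. f t (g t))"
  unfolding continuous_on_def
proof
  fix t assume t: "t \<in> J"
  define A where "A = norm (g t) + 1"
  define N where "N = sun_star_norm sc T (f t)"
  have "((\<lambda>s. sun_star_norm sc T (f s - f t) * norm (g s) + N * norm (g s - g t)) \<longlongrightarrow> 0 * norm (g t) + N * norm (g t - g t)) (at t within J)"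
    using f(1) g(1) t by (intro tendsto_intros) (auto simp: norm_continuous_on_def continuous_on_def)
  then have lim: "((\<lambda>s. sun_star_norm sc T (f s - f t) * norm (g s) + N * norm (g s - g t)) \<longlongrightarrow> 0) (at t within J)"
    by simp
  have "norm (f s (g s) - f t (g t)) \<le> sun_star_norm sc T (f s - f t) * norm (g s) + N * norm (g s - g t)"
    if s: "s \<in> J" for s
  proof -
    have "f s (g s) - f t (g t) = (f s - f t) (g s) + f t (g s - g t)"
      using f(2) g(2) s t by (subst sun_star_diff_arg) auto
    also have "norm \<dots> \<le> sun_star_norm sc T (f s - f t) * norm (g s) + N * norm (g s - g t)"
      unfolding N_def using f(2) g(2) s t
      by (intro norm_triangle_mono sun_star_le_norm sun_star_diff sun_diff) auto
    finally show ?thesis .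
  qed
  then have "((\<lambda>s. f s (g s) - f t (g t)) \<longlongrightarrow> 0) (at t within J)"
    by (intro Lim_null_comparison[OF _ lim]) (auto simp: eventually_at_filter)
  then show "((\<lambda>s. f s (g s)) \<longlongrightarrow> f t (g t)) (at t within J)" by (rule LIM_zero_cancel)
qed

section \<open>The range of the canonical embedding\<close>

lemma j_apply: "x' \<in> X_sun \<Longrightarrow> j x x' = x' x"
  by (simp add: sun_emb_def)

lemma sun_separates: "x = y" if "\<And>x'. x' \<in> X_sun \<Longrightarrow> blinfun_apply x' x = x' y"
proof -
  obtain M where "\<And>x B. (\<forall>x'\<in>X_sun. norm (blinfun_apply x' x) \<le> B * norm x') \<Longrightarrow> norm x \<le> M * \<bar>B\<bar>"
    using sun_dual_norming by blast
  from this[of "x - y" 0] show ?thesis using that by (simp add: blinfun.diff_right)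
qed

lemma inv_j_apply: "blinfun_apply x' (inv j F) = F x'" if "F \<in> range j" "x' \<in> X_sun"
  using that by (metis f_inv_into_f j_apply)

lemma range_jI:
  assumes "\<And>x'. x' \<in> X_sun \<Longrightarrow> F x' = blinfun_apply x' y" "\<And>x'. x' \<notin> X_sun \<Longrightarrow> F x' = 0"
  shows "F \<in> range j"
proof -
  have "F = j y" using assms by (auto simp: sun_emb_def fun_eq_iff)
  then show ?thesis by simp
qed

text \<open>Norm limits of elements of \<open>jX\<close> come from Cauchy sequences in \<open>X\<close>, since \<open>j\<close> is bounded below.\<close>
lemma range_j_closed:
  assumes app: "\<And>e. e > 0 \<Longrightarrow> \<exists>x. \<forall>x'\<in>X_sun. norm (F x' - blinfun_apply x' x) \<le> e * norm x'"
    and off: "\<And>x'. x' \<notin> X_sun \<Longrightarrow> F x' = 0"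
  shows "F \<in> range j"
proof -
  obtain M where M: "M \<ge> 1"
      "\<And>x B. (\<forall>x'\<in>X_sun. norm (blinfun_apply x' x) \<le> B * norm x') \<Longrightarrow> norm x \<le> M * \<bar>B\<bar>"
    using sun_dual_norming by blast
  have "\<forall>n. \<exists>x. \<forall>x'\<in>X_sun. norm (F x' - blinfun_apply x' x) \<le> (1 / real (Suc n)) * norm x'"
    by (intro allI app) simp
  then obtain x where x: "\<And>n x'. x' \<in> X_sun \<Longrightarrow> norm (F x' - blinfun_apply x' (x n)) \<le> (1 / real (Suc n)) * norm x'"
    by metis
  have diff: "norm (x m - x n) \<le> M * (1 / real (Suc m) + 1 / real (Suc n))" for m n
  proof -
    have "norm (blinfun_apply x' (x m - x n)) \<le> (1 / real (Suc m) + 1 / real (Suc n)) * norm x'" if "x' \<in> X_sun" for x'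
    proof -
      have "blinfun_apply x' (x m - x n) = (F x' - blinfun_apply x' (x n)) - (F x' - blinfun_apply x' (x m))"
        by (simp add: blinfun.diff_right)
      also have "norm \<dots> \<le> (1 / real (Suc n)) * norm x' + (1 / real (Suc m)) * norm x'"
        by (rule order_trans[OF norm_triangle_ineq4 add_mono[OF x[OF that] x[OF that]]])
      finally show ?thesis by (simp add: algebra_simps)
    qed
    then show ?thesis using M(2)[of "x m - x n" "1 / real (Suc m) + 1 / real (Suc n)"] by simp
  qed
  have "Cauchy x"
  proof (rule metric_CauchyI)
    fix e :: real assume e: "e > 0"
    obtain N where N: "2 * M / e < real N" using reals_Archimedean2 by blast
    have "dist (x m) (x n) < e" if "m \<ge> N" "n \<ge> N" for m n
    proof -
      have *: "1 / real (Suc k) < e / (2 * M)" if "k \<ge> N" for k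
      proof -
        have "2 * M / e < real (Suc k)" using N that by simp
        then show ?thesis using e M(1) by (simp add: field_simps)
      qed
      have "M * (1 / real (Suc m) + 1 / real (Suc n)) < M * (e / (2 * M) + e / (2 * M))"
        using M(1) *[OF that(1)] *[OF that(2)] by (intro mult_strict_left_mono add_strict_mono) auto
      also have "\<dots> = e" using M(1) by (simp add: field_simps)
      finally show ?thesis using diff[of m n] by (simp add: dist_norm)
    qed
    then show "\<exists>N. \<forall>m\<ge>N. \<forall>n\<ge>N. dist (x m) (x n) < e" by blast
  qed
  then obtain y where y: "x \<longlonglongrightarrow> y" using Cauchy_convergent convergentD by blast
  have "F x' = blinfun_apply x' y" if x': "x' \<in> X_sun" for x'
  proof -
    have "(\<lambda>n. F x' - blinfun_apply x' (x n)) \<longlonglongrightarrow> F x' - blinfun_apply x' y" by (intro tendsto_intros y)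
    moreover have "(\<lambda>n. F x' - blinfun_apply x' (x n)) \<longlonglongrightarrow> 0"
    proof (rule Lim_null_comparison)
      show "eventually (\<lambda>n. norm (F x' - blinfun_apply x' (x n)) \<le> (1 / real (Suc n)) * norm x') sequentially"
        by (rule always_eventually) (use x[OF x'] in blast)
      show "(\<lambda>n. (1 / real (Suc n)) * norm x') \<longlonglongrightarrow> 0"
        by (rule tendsto_mult_left_zero[OF LIMSEQ_Suc[OF lim_1_over_n]])
    qed
    ultimately have "F x' - blinfun_apply x' y = 0" by (rule LIMSEQ_unique)
    then show ?thesis by simp
  qed
  then show ?thesis using off by (rule range_jI)
qed

section \<open>Weak-star convolution integrals\<close>

lemma conv_apply: "x' \<in> X_sun \<Longrightarrow> conv f s t x' = integral {s..t} (\<lambda>\<tau>. f \<tau> (x' o\<^sub>L T (t - \<tau>)))"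
  and conv_off: "x' \<notin> X_sun \<Longrightarrow> conv f s t x' = 0"
  by (simp_all add: sun_star_convolution_def weak_star_integral_def sun_star_semigroup_def)

text \<open>All convolution integrals have continuous integrands, because orbits in the sun dual and \<open>f\<close> are
  norm continuous. The argument \<open>u\<close> may exceed the right end point \<open>t\<close>, as happens when an interval
  of integration is split.\<close>
lemma conv_integrand_continuous:
  assumes f: "norm_continuous_on sc T {s..t} f" "f ` {s..t} \<subseteq> X_sun_star" and x': "x' \<in> X_sun"
    and u: "t \<le> u"
  shows "continuous_on {s..t} (\<lambda>\<tau>. f \<tau> (x' o\<^sub>L T (u - \<tau>)))"
proof (rule pairing_continuous[OF f])
  show "continuous_on {s..t} (\<lambda>\<tau>. x' o\<^sub>L T (u - \<tau>))"
    by (rule continuous_on_compose2[OF sun_orbit_continuous[OF x']]) (use u in \<open>auto intro!: continuous_intros\<close>)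
qed (use x' u in \<open>auto intro: sun_compose\<close>)

lemma conv_integrable:
  assumes "norm_continuous_on sc T {s..t} f" "f ` {s..t} \<subseteq> X_sun_star" "x' \<in> X_sun" "t \<le> u"
  shows "(\<lambda>\<tau>. f \<tau> (x' o\<^sub>L T (u - \<tau>))) integrable_on {s..t}"
  by (intro integrable_continuous_real conv_integrand_continuous assms)

lemma conv_bound:
  assumes f: "norm_continuous_on sc T {s..t} f" "f ` {s..t} \<subseteq> X_sun_star" and x': "x' \<in> X_sun" and st: "s \<le> t"
    and B: "0 \<le> B" "\<And>\<tau> x'. \<tau> \<in> {s..t} \<Longrightarrow> x' \<in> X_sun \<Longrightarrow> norm (f \<tau> x') \<le> B * norm x'"
    and M: "\<And>r. r \<in> {0..t - s} \<Longrightarrow> norm (T r) \<le> M"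
  shows "norm (conv f s t x') \<le> B * M * (t - s) * norm x'"
proof -
  have "norm (integral {s..t} (\<lambda>\<tau>. f \<tau> (x' o\<^sub>L T (t - \<tau>)))) \<le> (B * (norm x' * M)) * (t - s)"
  proof (rule integral_bound[OF st conv_integrand_continuous[OF f x']])
    fix \<tau> assume \<tau>: "\<tau> \<in> {s..t}"
    then have "norm (f \<tau> (x' o\<^sub>L T (t - \<tau>))) \<le> B * norm (x' o\<^sub>L T (t - \<tau>))"
      using x' by (intro B sun_compose) auto
    also have "\<dots> \<le> B * (norm x' * norm (T (t - \<tau>)))"
      by (intro mult_left_mono norm_blinfun_compose B)
    also have "\<dots> \<le> B * (norm x' * M)" using M \<tau> B by (intro mult_left_mono) auto
    finally show "norm (f \<tau> (x' o\<^sub>L T (t - \<tau>))) \<le> B * (norm x' * M)" .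
  qed simp
  then show ?thesis by (simp add: conv_apply[OF x'] mult_ac)
qed

text \<open>The cocycle identity. On the right the operator \<open>T\<^sup>\<odot>\<^sup>*(u - t)\<close> shows up as a composition inside
  the argument.\<close>
lemma conv_split:
  assumes f: "norm_continuous_on sc T {s..u} f" "f ` {s..u} \<subseteq> X_sun_star" and x': "x' \<in> X_sun"
    and "s \<le> t" "t \<le> u"
  shows "conv f s u x' = conv f s t (x' o\<^sub>L T (u - t)) + conv f t u x'"
proof -
  have "conv f s u x' = integral {s..t} (\<lambda>\<tau>. f \<tau> (x' o\<^sub>L T (u - \<tau>))) + integral {t..u} (\<lambda>\<tau>. f \<tau> (x' o\<^sub>L T (u - \<tau>)))"
    using assms conv_integrable[OF f x']
    by (simp add: conv_apply Henstock_Kurzweil_Integration.integral_combine)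
  also have "integral {s..t} (\<lambda>\<tau>. f \<tau> (x' o\<^sub>L T (u - \<tau>))) = conv f s t (x' o\<^sub>L T (u - t))"
  proof -
    have "x' o\<^sub>L T (u - \<tau>) = (x' o\<^sub>L T (u - t)) o\<^sub>L T (t - \<tau>)" if "\<tau> \<in> {s..t}" for \<tau>
      using that assms(5) by (intro blinfun_eqI) (simp add: T_add_apply)
    then have "integral {s..t} (\<lambda>\<tau>. f \<tau> (x' o\<^sub>L T (u - \<tau>))) =
        integral {s..t} (\<lambda>\<tau>. f \<tau> ((x' o\<^sub>L T (u - t)) o\<^sub>L T (t - \<tau>)))"
      by (intro integral_cong arg_cong[of _ _ "f _"])
    then show ?thesis using x' assms(5) by (simp add: conv_apply sun_compose)
  qed
  finally show ?thesis using x' by (simp add: conv_apply)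
qed

lemma conv_cong: "(\<And>\<tau>. \<tau> \<in> {s..t} \<Longrightarrow> f \<tau> = g \<tau>) \<Longrightarrow> conv f s t = conv g s t"
  unfolding sun_star_convolution_def weak_star_integral_def sun_star_semigroup_def
  by (auto simp: fun_eq_iff intro!: integral_cong)

lemma conv_shift: "conv (\<lambda>\<tau>. f (c + \<tau>)) a b = conv f (a + c) (b + c)"
proof
  fix x'
  show "conv (\<lambda>\<tau>. f (c + \<tau>)) a b x' = conv f (a + c) (b + c) x'"
  proof (cases "x' \<in> X_sun")
    case True
    have "integral {a..b} (\<lambda>\<tau>. f (c + \<tau>) (x' o\<^sub>L T (b - \<tau>))) =
        integral {a..b} ((\<lambda>\<tau>. f \<tau> (x' o\<^sub>L T (b + c - \<tau>))) \<circ> (+) c)"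
      by (simp add: o_def)
    then show ?thesis using True by (simp only: conv_apply integral_shift_Icc_real)
  qed (simp add: conv_off)
qed

lemma conv_add:
  assumes f: "norm_continuous_on sc T {s..t} f" "f ` {s..t} \<subseteq> X_sun_star"
    and g: "norm_continuous_on sc T {s..t} g" "g ` {s..t} \<subseteq> X_sun_star"
  shows "conv (\<lambda>\<tau>. f \<tau> + g \<tau>) s t x' = conv f s t x' + conv g s t x'"
proof (cases "x' \<in> X_sun")
  case True
  then show ?thesis
    using conv_integrable[OF f True order_refl] conv_integrable[OF g True order_refl]
    by (simp add: conv_apply Henstock_Kurzweil_Integration.integral_add)
qed (simp add: conv_off)

section \<open>Convolutions lying in the range of the embedding\<close>

text \<open>Independence of the interval in the definition of admissibility. On intervals no longer than a
  piece \<open>[a, b]\<close> of the given interval \<open>J\<close>, translate the function and extend it to \<open>J\<close> by its end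
  values. Longer intervals are cut into such pieces by the cocycle identity, as
  \<open>T\<^sup>\<odot>\<^sup>*\<close> leaves \<open>jX\<close> invariant.\<close>
lemma admissible_convolution:
  assumes adm: "admissible_range sc T S"
    and f: "norm_continuous_on sc T {s..t} f" "f ` {s..t} \<subseteq> S" and st: "s \<le> t"
  shows "conv f s t \<in> range j"
proof -
  obtain J a b where J: "is_interval J" "a \<in> J" "b \<in> J" "a < b"
    and adm_J: "\<And>f s t. norm_continuous_on sc T J f \<Longrightarrow> f ` J \<subseteq> S \<Longrightarrow> s \<in> J \<Longrightarrow> t \<in> J \<Longrightarrow> s \<le> t \<Longrightarrow>
        conv f s t \<in> range j"
    using adm unfolding admissible_range_def by auto
  have S: "S \<subseteq> X_sun_star" using adm by (simp add: admissible_range_def closed_sun_star_subspace_def)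
  have short: "conv f s t \<in> range j"
    if f: "norm_continuous_on sc T {s..t} f" "f ` {s..t} \<subseteq> S" and st: "s \<le> t" "t - s \<le> b - a" for s t
  proof -
    define g where "g \<tau> = f (max s (min t (s - a + \<tau>)))" for \<tau>
    have "norm_continuous_on sc T J g"
      unfolding g_def
      by (rule norm_continuous_on_compose[OF f(1)]) (use f(2) S st in \<open>auto intro!: continuous_intros\<close>)
    moreover have "g ` J \<subseteq> S" using f(2) st by (auto simp: g_def)
    moreover have "a + (t - s) \<in> J"
      by (rule mem_is_interval_1_I[OF J(1-3)]) (use st in auto)
    ultimately have "conv g a (a + (t - s)) \<in> range j" using J st by (intro adm_J) auto
    also have "conv g a (a + (t - s)) = conv (\<lambda>\<tau>. f (s - a + \<tau>)) a (a + (t - s))"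
    proof (rule conv_cong)
      fix \<tau> assume "\<tau> \<in> {a..a + (t - s)}"
      then have "max s (min t (s - a + \<tau>)) = s - a + \<tau>" by (auto simp: max_def min_def)
      then show "g \<tau> = f (s - a + \<tau>)" by (simp add: g_def)
    qed
    also have "\<dots> = conv f s t" by (simp add: conv_shift)
    finally show ?thesis .
  qed
  have "conv f s t \<in> range j"
    if "norm_continuous_on sc T {s..t} f" "f ` {s..t} \<subseteq> S" "s \<le> t" "t - s \<le> real n * (b - a)" for n t
    using that
  proof (induction n arbitrary: t)
    case 0
    then show ?case using J by (intro short) auto
  next
    case (Suc n)
    show ?case
    proof (cases "t - s \<le> b - a")
      case False
      define r where "r = t - (b - a)"
      have r: "s \<le> r" "r \<le> t" using False J by (auto simp: r_def)
      have "conv f s r \<in> range j"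
        using Suc.prems r by (intro Suc.IH norm_continuous_on_subset[OF Suc.prems(1)])
          (auto simp: r_def algebra_simps)
      then obtain y where y: "conv f s r = j y" by auto
      have "conv f r t \<in> range j"
        using Suc.prems r by (intro short norm_continuous_on_subset[OF Suc.prems(1)]) (auto simp: r_def)
      then obtain z where z: "conv f r t = j z" by auto
      show ?thesis
      proof (rule range_jI)
        show "conv f s t x' = blinfun_apply x' (T (t - r) y + z)" if "x' \<in> X_sun" for x'
          using conv_split[OF Suc.prems(1) _ that r] Suc.prems(2) S y z that r
          by (auto simp: j_apply sun_compose blinfun.add_right)
      qed (simp add: conv_off)
    qed (use Suc.prems in \<open>intro short\<close>)
  qed
  moreover obtain n where "(t - s) / (b - a) < real n" using reals_Archimedean2 by blast
  then have "t - s \<le> real n * (b - a)" using J by (simp add: field_simps)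
  ultimately show ?thesis using f st by blast
qed

text \<open>Second-order approximability by \<open>jX\<close> on short intervals suffices for membership in \<open>jX\<close>. With \<open>n\<close>
  pieces of length \<open>h\<close> the errors \<open>C h\<^sup>2\<close> are propagated by the semigroup and summed, which gives
  at most \<open>n M C h\<^sup>2\<close>.\<close>
lemma convolution_in_range_if_locally:
  assumes f: "norm_continuous_on sc T {s..t} f" "f ` {s..t} \<subseteq> X_sun_star" and st: "s \<le> t"
    and loc: "\<And>a b. s \<le> a \<Longrightarrow> a \<le> b \<Longrightarrow> b \<le> t \<Longrightarrow>
        \<exists>y. \<forall>x'\<in>X_sun. norm (conv f a b x' - blinfun_apply x' y) \<le> C * (b - a)\<^sup>2 * norm x'"
  shows "conv f s t \<in> range j"
proof (rule range_j_closed)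
  obtain M where M: "M \<ge> 1" "\<And>r. r \<in> {0..t - s} \<Longrightarrow> norm (T r) \<le> M" using T_bounded by blast
  fix e :: real assume e: "e > 0"
  define D where "D = M * \<bar>C\<bar> * (t - s)\<^sup>2"
  obtain n where n: "D / e < real n" using reals_Archimedean2 by blast
  have D0: "D \<ge> 0" using M by (simp add: D_def)
  have "0 \<le> D / e" using D0 e by simp
  then have n0: "n > 0" using n by (intro Nat.gr0I) auto
  define h where "h = (t - s) / real n"
  have h: "h \<ge> 0" "real n * h = t - s" using st n0 by (auto simp: h_def)
  \<comment> \<open>The error after \<open>k\<close> pieces is measured after every further propagation by \<open>T r\<close>. Estimating it
      only at \<open>r = 0\<close> would cost a factor \<open>M\<close> per piece, hence \<open>M ^ n\<close> in the end.\<close>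
  have "\<exists>y. \<forall>r. 0 \<le> r \<and> r \<le> t - (s + real k * h) \<longrightarrow> (\<forall>x'\<in>X_sun.
      norm (conv f s (s + real k * h) (x' o\<^sub>L T r) - blinfun_apply x' (T r y)) \<le> real k * (M * \<bar>C\<bar> * h\<^sup>2) * norm x')"
    if "k \<le> n" for k
    using that
  proof (induction k)
    case 0
    have "conv f s s x' = 0" for x' by (cases "x' \<in> X_sun") (simp_all add: conv_apply conv_off)
    then show ?case by (intro exI[of _ 0]) simp
  next
    case (Suc k)
    let ?p = "s + real k * h" and ?q = "s + real (Suc k) * h"
    have "real (Suc k) * h \<le> real n * h" using Suc.prems h by (intro mult_right_mono) auto
    then have q: "?q \<le> t" using h by simp
    have p: "s \<le> ?p" "?p \<le> ?q" "?q - ?p = h" using h by (auto simp: algebra_simps)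
    obtain y where y: "\<And>r x'. 0 \<le> r \<Longrightarrow> r \<le> t - ?p \<Longrightarrow> x' \<in> X_sun \<Longrightarrow>
      norm (conv f s ?p (x' o\<^sub>L T r) - blinfun_apply x' (T r y)) \<le> real k * (M * \<bar>C\<bar> * h\<^sup>2) * norm x'"
      using Suc by (meson Suc_leD)
    obtain z where z: "\<And>x'. x' \<in> X_sun \<Longrightarrow> norm (conv f ?p ?q x' - blinfun_apply x' z) \<le> C * h\<^sup>2 * norm x'"
      using loc[OF p(1,2) q] unfolding p(3) by blast
    have fq: "norm_continuous_on sc T {s..?q} f" "f ` {s..?q} \<subseteq> X_sun_star"
      using f q by (auto intro: norm_continuous_on_subset[OF f(1)])
    have "norm (conv f s ?q (x' o\<^sub>L T r) - blinfun_apply x' (T r (T h y + z))) \<le> real (Suc k) * (M * \<bar>C\<bar> * h\<^sup>2) * norm x'"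
      if r: "0 \<le> r" "r \<le> t - ?q" and x': "x' \<in> X_sun" for r x'
    proof -
      have xr: "x' o\<^sub>L T r \<in> X_sun" by (rule sun_compose[OF x' r(1)])
      have "(x' o\<^sub>L T r) o\<^sub>L T h = x' o\<^sub>L T (r + h)"
        using r h by (intro blinfun_eqI) (simp add: T_add_apply)
      then have "conv f s ?q (x' o\<^sub>L T r) = conv f s ?p (x' o\<^sub>L T (r + h)) + conv f ?p ?q (x' o\<^sub>L T r)"
        using conv_split[OF fq xr p(1,2)] p(3) by simp
      then have "conv f s ?q (x' o\<^sub>L T r) - blinfun_apply x' (T r (T h y + z)) =
          (conv f s ?p (x' o\<^sub>L T (r + h)) - x' (T (r + h) y)) + (conv f ?p ?q (x' o\<^sub>L T r) - (x' o\<^sub>L T r) z)"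
        using r h by (simp add: blinfun.add_right T_add_apply)
      also have "norm \<dots> \<le> real k * (M * \<bar>C\<bar> * h\<^sup>2) * norm x' + \<bar>C\<bar> * h\<^sup>2 * (norm x' * M)"
      proof (rule norm_triangle_mono)
        show "norm (conv f s ?p (x' o\<^sub>L T (r + h)) - x' (T (r + h) y)) \<le> real k * (M * \<bar>C\<bar> * h\<^sup>2) * norm x'"
          using r h x' p by (intro y) (auto simp: algebra_simps)
        have "norm (conv f ?p ?q (x' o\<^sub>L T r) - (x' o\<^sub>L T r) z) \<le> C * h\<^sup>2 * norm (x' o\<^sub>L T r)" by (rule z[OF xr])
        also have "\<dots> \<le> \<bar>C\<bar> * h\<^sup>2 * norm (x' o\<^sub>L T r)" by (intro mult_right_mono) auto
        also have "\<dots> \<le> \<bar>C\<bar> * h\<^sup>2 * (norm x' * norm (T r))" by (intro mult_left_mono norm_blinfun_compose) auto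
        also have "\<dots> \<le> \<bar>C\<bar> * h\<^sup>2 * (norm x' * M)"
        proof (intro mult_left_mono M)
          show "r \<in> {0..t - s}" unfolding atLeastAtMost_iff using r p(1,2) by linarith
        qed auto
        finally show "norm (conv f ?p ?q (x' o\<^sub>L T r) - (x' o\<^sub>L T r) z) \<le> \<bar>C\<bar> * h\<^sup>2 * (norm x' * M)" .
      qed
      also have "\<dots> = real (Suc k) * (M * \<bar>C\<bar> * h\<^sup>2) * norm x'" by (simp add: algebra_simps)
      finally show ?thesis .
    qed
    then show ?case by blast
  qed
  from this[OF order_refl] obtain y where y: "\<And>x'. x' \<in> X_sun \<Longrightarrow>
      norm (conv f s t (x' o\<^sub>L T 0) - blinfun_apply x' (T 0 y)) \<le> real n * (M * \<bar>C\<bar> * h\<^sup>2) * norm x'"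
    unfolding h(2) by force
  have "real n * (M * \<bar>C\<bar> * h\<^sup>2) = D / real n"
    using n0 by (simp add: D_def h_def power2_eq_square field_simps)
  also have "\<dots> \<le> e" using n e n0 by (simp add: field_simps)
  finally have le: "real n * (M * \<bar>C\<bar> * h\<^sup>2) \<le> e" .
  have "norm (conv f s t x' - blinfun_apply x' y) \<le> e * norm x'" if x': "x' \<in> X_sun" for x'
  proof -
    have "x' o\<^sub>L T 0 = x'" by (intro blinfun_eqI) (simp add: T_zero)
    then show ?thesis using y[OF x'] mult_right_mono[OF le, of "norm x'"] by (simp add: T_zero)
  qed
  then show "\<exists>y. \<forall>x'\<in>X_sun. norm (conv f s t x' - blinfun_apply x' y) \<le> e * norm x'" by blast
qed (simp add: conv_off)

section \<open>Functions that are nearly orbits\<close>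

text \<open>The function \<open>s \<mapsto> T (c - s) (e s)\<close> changes by order \<open>(b - a)\<^sup>2\<close> over \<open>[a, b]\<close>, so its derivative
  vanishes and it is constant; its end values are \<open>T c (e 0)\<close> and \<open>e c\<close>.\<close>
lemma orbit_defect_zero:
  assumes e: "\<And>a b. 0 \<le> a \<Longrightarrow> a \<le> b \<Longrightarrow> b \<le> c \<Longrightarrow> norm (e b - T (b - a) (e a)) \<le> C * (b - a)\<^sup>2"
    and "e 0 = 0" "0 \<le> c"
  shows "e c = 0"
proof -
  obtain M where M: "M \<ge> 1" "\<And>r. r \<in> {0..c} \<Longrightarrow> norm (T r) \<le> M" using T_bounded by blast
  define g where "g s = T (c - s) (e s)" for s
  have g1: "norm (g b - g a) \<le> M * \<bar>C\<bar> * (b - a)\<^sup>2" if "0 \<le> a" "a \<le> b" "b \<le> c" for a b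
  proof -
    have "g b - g a = T (c - b) (e b - T (b - a) (e a))"
      using that by (simp add: g_def blinfun.diff_right T_add_apply)
    also have "norm \<dots> \<le> norm (T (c - b)) * norm (e b - T (b - a) (e a))" by (rule norm_blinfun)
    also have "\<dots> \<le> M * (\<bar>C\<bar> * (b - a)\<^sup>2)"
      using that M order_trans[OF e[OF that] mult_right_mono[OF abs_ge_self zero_le_power2]]
      by (intro mult_mono) auto
    finally show ?thesis by (simp add: mult.assoc)
  qed
  have g2: "norm (g b - g a) \<le> M * \<bar>C\<bar> * \<bar>b - a\<bar> * \<bar>b - a\<bar>" if "a \<in> {0..c}" "b \<in> {0..c}" for a b
    using g1[of a b] g1[of b a] that
    by (cases "a \<le> b") (auto simp: norm_minus_commute power2_eq_square mult.assoc)
  have "(g has_derivative (\<lambda>_. 0)) (at a within {0..c})" if a: "a \<in> {0..c}" for a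
  proof (rule has_derivativeI_sandwich[of 1])
    have "((\<lambda>b. M * \<bar>C\<bar> * \<bar>b - a\<bar>) \<longlongrightarrow> M * \<bar>C\<bar> * \<bar>a - a\<bar>) (at a within {0..c})" by (intro tendsto_intros)
    then show "((\<lambda>b. M * \<bar>C\<bar> * \<bar>b - a\<bar>) \<longlongrightarrow> 0) (at a within {0..c})" by simp
    show "norm (g b - g a - 0) / norm (b - a) \<le> M * \<bar>C\<bar> * \<bar>b - a\<bar>"
      if "b \<in> {0..c}" "b \<noteq> a" for b
      using g2[OF a that(1)] that(2) by (simp add: divide_le_eq)
  qed auto
  then obtain k where k: "\<And>s. s \<in> {0..c} \<Longrightarrow> g s = k"
    using has_derivative_zero_constant[of "{0..c}" g] by auto
  have "g c = g 0" using k[of c] k[of 0] assms(3) by simp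
  then show ?thesis using assms(2) by (simp add: g_def T_zero)
qed

text \<open>Left continuity at \<open>t\<close> cannot be read off by comparing \<open>e t\<close> with \<open>T (t - s) (e s)\<close>, where the base
  point \<open>s\<close> moves. Instead \<open>e\<close> is compared near \<open>t\<close> with one orbit that starts at a fixed time \<open>a\<close>
  slightly before \<open>t\<close>.\<close>
lemma orbit_defect_continuous:
  assumes e: "\<And>a b. 0 \<le> a \<Longrightarrow> a \<le> b \<Longrightarrow> b \<le> c \<Longrightarrow> norm (e b - T (b - a) (e a)) \<le> C * (b - a)"
  shows "continuous_on {0..c} e"
  unfolding continuous_on_iff
proof (intro ballI allI impI)
  fix t \<epsilon> :: real assume t: "t \<in> {0..c}" and \<epsilon>: "\<epsilon> > 0"
  define d where "d = \<epsilon> / (6 * (\<bar>C\<bar> + 1))"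
  have "d > 0" using \<epsilon> by (simp add: d_def)
  have d: "\<bar>C\<bar> * (2 * d) \<le> \<epsilon> / 3" using \<epsilon> by (simp add: d_def field_simps)
  define a where "a = max 0 (t - d)"
  have a: "0 \<le> a" "a \<le> t" "t - a \<le> d" "t = 0 \<or> a < t" using t \<open>d > 0\<close> by (auto simp: a_def)
  have near: "norm (e s - T (s - a) (e a)) \<le> \<epsilon> / 3" if "a \<le> s" "s \<le> c" "s \<le> t + d" for s
  proof -
    have "norm (e s - T (s - a) (e a)) \<le> C * (s - a)" using that a by (intro e) auto
    also have "\<dots> \<le> \<bar>C\<bar> * (2 * d)" using that a by (intro mult_mono) auto
    finally show ?thesis using d by simp
  qed
  have "continuous_on {a..} (\<lambda>s. T (s - a) (e a))"
    by (rule continuous_on_compose2[OF T_continuous]) (auto intro!: continuous_intros)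
  then obtain d' where d': "d' > 0" "\<And>s. s \<ge> a \<Longrightarrow> dist s t < d' \<Longrightarrow>
      dist (T (s - a) (e a)) (T (t - a) (e a)) < \<epsilon> / 3"
    unfolding continuous_on_iff using a(2) \<epsilon> by (metis atLeast_iff zero_less_divide_iff zero_less_numeral)
  define d'' where "d'' = min d' (if t = 0 then d else min d (t - a))"
  have "d'' > 0" using d'(1) \<open>d > 0\<close> a(4) by (auto simp: d''_def)
  moreover have "dist (e s) (e t) < \<epsilon>" if s: "s \<in> {0..c}" "dist s t < d''" for s
  proof -
    have s': "a \<le> s" "s \<le> t + d" "dist s t < d'"
      using s a by (auto simp: d''_def dist_real_def split: if_splits)
    have "dist (e s) (e t) \<le> dist (e s) (T (s - a) (e a)) + dist (T (s - a) (e a)) (T (t - a) (e a))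
        + dist (T (t - a) (e a)) (e t)"
      by (meson add_mono dist_triangle order_refl order_trans)
    also have "\<dots> < \<epsilon> / 3 + \<epsilon> / 3 + \<epsilon> / 3"
      using near[of s] near[of t] d'(2)[of s] s s' a t \<open>d > 0\<close>
      by (intro add_less_le_mono add_le_less_mono) (auto simp: dist_norm norm_minus_commute)
    finally show ?thesis by simp
  qed
  ultimately show "\<exists>d>0. \<forall>s\<in>{0..c}. dist s t < d \<longrightarrow> dist (e s) (e t) < \<epsilon>" by blast
qed

end

section \<open>Comparison of the two semigroups\<close>

text \<open>That \<open>T\<close> is a \<open>C\<^sub>0\<close>-semigroup is part of \<open>perturbed_semigroup\<close>; assuming it once more through
  \<open>sun_duality\<close> makes the results about \<open>T\<^sub>0\<close> available for \<open>T\<close> under a prefix of its own.\<close>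
locale sun_perturbation = T0: sun_duality sc T0 + T: sun_duality sc T
  for sc :: "'k::{real_normed_field,euclidean_space} \<Rightarrow> 'a::banach \<Rightarrow> 'a"
    and T0 T :: "real \<Rightarrow> 'a \<Rightarrow>\<^sub>L 'a" +
  fixes X0 :: "(('a \<Rightarrow>\<^sub>L 'k) \<Rightarrow> 'k) set" and L :: "'a \<Rightarrow> ('a \<Rightarrow>\<^sub>L 'k) \<Rightarrow> 'k"
  assumes adm: "admissible_range sc T0 X0"
    and L: "bounded_linear_into_sun_star sc T0 L" and L_range: "range L \<subseteq> X0"
    and pert: "perturbed_semigroup sc T0 L T"
begin

lemma X0_subset: "X0 \<subseteq> T0.X_sun_star"
  using adm by (simp add: admissible_range_def closed_sun_star_subspace_def)

lemma X0_add: "F \<in> X0 \<Longrightarrow> G \<in> X0 \<Longrightarrow> F + G \<in> X0"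
proof -
  interpret V: vector_space "fun_scale :: 'k \<Rightarrow> (('a \<Rightarrow>\<^sub>L 'k) \<Rightarrow> 'k) \<Rightarrow> _" by (rule vector_space_fun_scale)
  show "F \<in> X0 \<Longrightarrow> G \<in> X0 \<Longrightarrow> F + G \<in> X0"
    using adm by (auto simp: admissible_range_def closed_sun_star_subspace_def intro: V.subspace_add)
qed

lemma L_in_sun_star: "L x \<in> T0.X_sun_star"
  using L by (auto simp: bounded_linear_into_sun_star_def)

lemma L_add: "L (x + y) = L x + L y"
  using L by (simp add: bounded_linear_into_sun_star_def Vector_Spaces.linear_iff)

lemma L_diff: "L (x - y) = L x - L y"
  using L_add[of "x - y" y] by (simp add: algebra_simps)

lemma L_bounded: "\<exists>K\<ge>0. \<forall>x. \<forall>x'\<in>T0.X_sun. norm (L x x') \<le> K * norm x * norm x'"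
proof -
  obtain K where K: "\<And>x. sun_star_norm sc T0 (L x) \<le> K * norm x"
    using L by (auto simp: bounded_linear_into_sun_star_def)
  have "norm (L x x') \<le> \<bar>K\<bar> * norm x * norm x'" if x': "x' \<in> T0.X_sun" for x x'
  proof -
    have "norm (L x x') \<le> sun_star_norm sc T0 (L x) * norm x'"
      by (rule T0.sun_star_le_norm[OF L_in_sun_star x'])
    also have "\<dots> \<le> \<bar>K\<bar> * norm x * norm x'"
      by (intro mult_right_mono order_trans[OF K]) auto
    finally show ?thesis .
  qed
  then show ?thesis by (intro exI[of _ "\<bar>K\<bar>"]) auto
qed

lemma L_image: "(\<lambda>\<tau>. L (g \<tau>)) ` J \<subseteq> T0.X_sun_star" "(\<lambda>\<tau>. L (g \<tau>)) ` J \<subseteq> X0"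
  using L_in_sun_star L_range by auto

lemma L_norm_continuous:
  assumes g: "continuous_on J g"
  shows "norm_continuous_on sc T0 J (\<lambda>\<tau>. L (g \<tau>))"
  unfolding norm_continuous_on_def
proof
  fix t assume t: "t \<in> J"
  obtain K where K: "\<And>x. sun_star_norm sc T0 (L x) \<le> K * norm x"
    using L by (auto simp: bounded_linear_into_sun_star_def)
  have "((\<lambda>s. K * norm (g s - g t)) \<longlongrightarrow> K * norm (g t - g t)) (at t within J)"
    using g t by (intro tendsto_intros) (auto simp: continuous_on_def)
  then have lim: "((\<lambda>s. K * norm (g s - g t)) \<longlongrightarrow> 0) (at t within J)" by simp
  show "((\<lambda>s. sun_star_norm sc T0 (L (g s) - L (g t))) \<longlongrightarrow> 0) (at t within J)"
  proof (rule tendsto_sandwich[OF always_eventually always_eventually tendsto_const lim]; rule allI)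
    show "0 \<le> sun_star_norm sc T0 (L (g s) - L (g t))" for s
      by (intro T0.sun_star_norm_nonneg T0.sun_star_diff L_in_sun_star)
    show "sun_star_norm sc T0 (L (g s) - L (g t)) \<le> K * norm (g s - g t)" for s
      using K[of "g s - g t"] by (simp add: L_diff)
  qed
qed

lemma L_conv_in_range: "continuous_on {s..t} g \<Longrightarrow> s \<le> t \<Longrightarrow> T0.conv (\<lambda>\<tau>. L (g \<tau>)) s t \<in> range T0.j"
  by (intro T0.admissible_convolution[OF adm] L_norm_continuous L_image)

text \<open>The constant depends only on the length of the interval. In the estimates below the bound \<open>G\<close> is
  itself of order \<open>b - a\<close>, which yields the second order.\<close>
lemma L_conv_bounded:
  "\<exists>Q\<ge>0. \<forall>a b g G. \<forall>x'\<in>T0.X_sun. a \<le> b \<and> b - a \<le> c \<and> 0 \<le> G \<and> continuous_on {a..b} g \<and>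
     (\<forall>\<tau>\<in>{a..b}. norm (g \<tau>) \<le> G) \<longrightarrow>
     norm (T0.conv (\<lambda>\<tau>. L (g \<tau>)) a b x') \<le> Q * G * (b - a) * norm x'"
proof -
  obtain K where K: "K \<ge> 0" "\<And>x x'. x' \<in> T0.X_sun \<Longrightarrow> norm (L x x') \<le> K * norm x * norm x'"
    using L_bounded by blast
  obtain M where M: "M \<ge> 1" "\<And>r. r \<in> {0..c} \<Longrightarrow> norm (T0 r) \<le> M" using T0.T_bounded by blast
  have "norm (T0.conv (\<lambda>\<tau>. L (g \<tau>)) a b x') \<le> K * M * G * (b - a) * norm x'"
    if x': "x' \<in> T0.X_sun" and ab: "a \<le> b" "b - a \<le> c" and g: "continuous_on {a..b} g"
      and G: "0 \<le> G" "\<And>\<tau>. \<tau> \<in> {a..b} \<Longrightarrow> norm (g \<tau>) \<le> G" for a b g G x'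
  proof -
    have "norm (T0.conv (\<lambda>\<tau>. L (g \<tau>)) a b x') \<le> (K * G) * M * (b - a) * norm x'"
    proof (rule T0.conv_bound[OF L_norm_continuous[OF g] L_image(1) x' ab(1)])
      show "norm (L (g \<tau>) y') \<le> K * G * norm y'" if "\<tau> \<in> {a..b}" "y' \<in> T0.X_sun" for \<tau> y'
        by (rule order_trans[OF K(2)[OF that(2)]]) (intro mult_right_mono mult_left_mono G that K(1) norm_ge_zero)
    qed (use K G M ab in auto)
    then show ?thesis by (simp add: mult_ac)
  qed
  then show ?thesis using K M by (intro exI[of _ "K * M"]) auto
qed

text \<open>The defining equation of \<open>T\<close>, tested against the sun dual and translated to \<open>[a, b]\<close>.
  Admissibility enters here: without it \<open>j\<^sup>-\<^sup>1\<close> in that equation would carry no information.\<close>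
lemma variation_of_constants:
  assumes "a \<le> b" "x' \<in> T0.X_sun"
  shows "blinfun_apply x' (T (b - a) y) = x' (T0 (b - a) y) + T0.conv (\<lambda>\<tau>. L (T (\<tau> - a) y)) a b x'"
proof -
  have cont: "continuous_on {0..b - a} (\<lambda>\<tau>. T \<tau> y)"
    by (rule continuous_on_subset[OF T.T_continuous]) auto
  have "T (b - a) y = T0 (b - a) y + inv T0.j (T0.conv (\<lambda>\<tau>. L (T \<tau> y)) 0 (b - a))"
    using pert assms(1) by (simp add: perturbed_semigroup_def)
  then have "blinfun_apply x' (T (b - a) y) = x' (T0 (b - a) y) + T0.conv (\<lambda>\<tau>. L (T \<tau> y)) 0 (b - a) x'"
    using assms L_conv_in_range[OF cont] by (simp add: blinfun.add_right T0.inv_j_apply)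
  also have "T0.conv (\<lambda>\<tau>. L (T \<tau> y)) 0 (b - a) = T0.conv (\<lambda>\<tau>. L (T (\<tau> - a) y)) a b"
    using T0.conv_shift[of "\<lambda>\<tau>. L (T (\<tau> - a) y)" a 0 "b - a"] by simp
  finally show ?thesis .
qed

lemma semigroups_close: "\<exists>C\<ge>0. \<forall>t\<in>{0..c}. norm (T t - T0 t) \<le> C * t"
proof -
  obtain Q where Q: "Q \<ge> 0" "\<And>a b g G x'. x' \<in> T0.X_sun \<Longrightarrow> a \<le> b \<Longrightarrow> b - a \<le> c \<Longrightarrow> 0 \<le> G \<Longrightarrow>
      continuous_on {a..b} g \<Longrightarrow> (\<forall>\<tau>\<in>{a..b}. norm (g \<tau>) \<le> G) \<Longrightarrow>
      norm (T0.conv (\<lambda>\<tau>. L (g \<tau>)) a b x') \<le> Q * G * (b - a) * norm x'"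
    using L_conv_bounded[of c] by blast
  obtain M where M: "M \<ge> 1" "\<And>r. r \<in> {0..c} \<Longrightarrow> norm (T r) \<le> M" using T.T_bounded by blast
  obtain N where N: "N \<ge> 1"
      "\<And>x B. (\<forall>x'\<in>T0.X_sun. norm (blinfun_apply x' x) \<le> B * norm x') \<Longrightarrow> norm x \<le> N * \<bar>B\<bar>"
    using T0.sun_dual_norming by blast
  have "norm (T t - T0 t) \<le> (N * Q * M) * t" if t: "t \<in> {0..c}" for t
  proof (rule norm_blinfun_bound)
    show "0 \<le> N * Q * M * t" using N Q M t by auto
    fix x
    have "norm (blinfun_apply x' ((T t - T0 t) x)) \<le> (Q * (M * norm x) * t) * norm x'" if x': "x' \<in> T0.X_sun" for x'
    proof -
      have "blinfun_apply x' ((T t - T0 t) x) = T0.conv (\<lambda>\<tau>. L (T \<tau> x)) 0 t x'"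
        using variation_of_constants[of 0 t x' x] t x' by (simp add: blinfun.diff_right blinfun.diff_left)
      moreover have "norm (T0.conv (\<lambda>\<tau>. L (T \<tau> x)) 0 t x') \<le> Q * (M * norm x) * (t - 0) * norm x'"
      proof (rule Q(2)[OF x'])
        show "\<forall>\<tau>\<in>{0..t}. norm (T \<tau> x) \<le> M * norm x"
          using t by (intro ballI order_trans[OF norm_blinfun] mult_right_mono M) auto
      qed (use t M in \<open>auto intro: continuous_on_subset[OF T.T_continuous]\<close>)
      ultimately show ?thesis by simp
    qed
    then have "norm ((T t - T0 t) x) \<le> N * \<bar>Q * (M * norm x) * t\<bar>" by (intro N(2)) blast
    also have "\<bar>Q * (M * norm x) * t\<bar> = Q * (M * norm x) * t" using Q M t by (intro abs_of_nonneg) auto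
    finally show "norm ((T t - T0 t) x) \<le> N * Q * M * t * norm x" by (simp add: mult_ac)
  qed
  then show ?thesis using N Q M by (intro exI[of _ "N * Q * M"]) auto
qed

text \<open>The adjoint orbits under the two semigroups differ by order \<open>t\<close> in norm, so one is continuous at
  zero exactly when the other is.\<close>
lemma sun_dual_eq: "sun_dual sc T = sun_dual sc T0"
proof -
  obtain C where C: "C \<ge> 0" "\<And>t. t \<in> {0..1} \<Longrightarrow> norm (T t - T0 t) \<le> C * t"
    using semigroups_close[of 1] by blast
  have close: "norm ((x' o\<^sub>L T t) - (x' o\<^sub>L T0 t)) \<le> norm x' * C * t" if "t \<in> {0..1}" for x' :: "'a \<Rightarrow>\<^sub>L 'k" and t
  proof -
    have "(x' o\<^sub>L T t) - (x' o\<^sub>L T0 t) = x' o\<^sub>L (T t - T0 t)"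
      by (intro blinfun_eqI) (simp add: blinfun.diff_left blinfun.diff_right)
    also have "norm \<dots> \<le> norm x' * norm (T t - T0 t)" by (rule norm_blinfun_compose)
    also have "\<dots> \<le> norm x' * (C * t)" using C that by (intro mult_left_mono) auto
    finally show ?thesis by (simp add: mult.assoc)
  qed
  have lim: "((\<lambda>t. norm x' * C * t + r t) \<longlongrightarrow> 0) (at_right 0)" if "(r \<longlongrightarrow> 0) (at_right 0)" for r and x' :: "'a \<Rightarrow>\<^sub>L 'k"
  proof -
    have "((\<lambda>t. norm x' * C * t + r t) \<longlongrightarrow> norm x' * C * 0 + 0) (at_right 0)" by (intro tendsto_intros that)
    then show ?thesis by simp
  qed
  show ?thesis
  proof (intro set_eqI iffI)
    fix x' assume x': "x' \<in> sun_dual sc T"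
    show "x' \<in> sun_dual sc T0"
    proof (rule T0.sun_dualI[OF T.sun_in_dual[OF x'] zero_less_one _ lim[OF T.sun_tendsto[OF x']]])
      fix t :: real assume "0 < t" "t < 1"
      then show "norm ((x' o\<^sub>L T0 t) - x') \<le> norm x' * C * t + norm ((x' o\<^sub>L T t) - x')"
        using close[of t x'] norm_triangle_ineq[of "(x' o\<^sub>L T0 t) - (x' o\<^sub>L T t)" "(x' o\<^sub>L T t) - x'"]
        by (simp add: norm_minus_commute)
    qed
  next
    fix x' assume x': "x' \<in> sun_dual sc T0"
    show "x' \<in> sun_dual sc T"
    proof (rule T.sun_dualI[OF T0.sun_in_dual[OF x'] zero_less_one _ lim[OF T0.sun_tendsto[OF x']]])
      fix t :: real assume "0 < t" "t < 1"
      then show "norm ((x' o\<^sub>L T t) - x') \<le> norm x' * C * t + norm ((x' o\<^sub>L T0 t) - x')"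
        using close[of t x'] norm_triangle_ineq[of "(x' o\<^sub>L T t) - (x' o\<^sub>L T0 t)" "(x' o\<^sub>L T0 t) - x'"]
        by simp
    qed
  qed
qed

lemma sun_star_eq: "sun_star sc T = sun_star sc T0"
  and sun_emb_eq: "sun_emb sc T = sun_emb sc T0"
  and sun_star_norm_eq: "sun_star_norm sc T = sun_star_norm sc T0"
  by (simp_all add: sun_star_def sun_emb_def sun_star_norm_def sun_dual_eq fun_eq_iff)

lemma norm_continuous_on_eq: "norm_continuous_on sc T = norm_continuous_on sc T0"
  by (simp add: norm_continuous_on_def sun_star_norm_eq fun_eq_iff)

text \<open>One factor \<open>b - a\<close> comes from the distance of the semigroups, the other from the length of the
  interval of integration.\<close>
lemma conv_close:
  "\<exists>C\<ge>0. \<forall>a b f B. \<forall>x'\<in>T0.X_sun. a \<le> b \<and> b - a \<le> c \<and> 0 \<le> B \<and> norm_continuous_on sc T0 {a..b} f \<and>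
     f ` {a..b} \<subseteq> T0.X_sun_star \<and> (\<forall>\<tau>\<in>{a..b}. \<forall>x'\<in>T0.X_sun. norm (f \<tau> x') \<le> B * norm x') \<longrightarrow>
     norm (T.conv f a b x' - T0.conv f a b x') \<le> C * B * (b - a)\<^sup>2 * norm x'"
proof -
  obtain C where C: "C \<ge> 0" "\<And>t. t \<in> {0..c} \<Longrightarrow> norm (T t - T0 t) \<le> C * t"
    using semigroups_close[of c] by blast
  have "norm (T.conv f a b x' - T0.conv f a b x') \<le> C * B * (b - a)\<^sup>2 * norm x'"
    if x': "x' \<in> T0.X_sun" and ab: "a \<le> b" "b - a \<le> c"
      and f: "norm_continuous_on sc T0 {a..b} f" "f ` {a..b} \<subseteq> T0.X_sun_star"
      and B: "B \<ge> 0" "\<And>\<tau> x'. \<tau> \<in> {a..b} \<Longrightarrow> x' \<in> T0.X_sun \<Longrightarrow> norm (f \<tau> x') \<le> B * norm x'" for a b f B x'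
  proof -
    have xT: "x' \<in> T.X_sun" using x' sun_dual_eq by simp
    have fT: "norm_continuous_on sc T {a..b} f" "f ` {a..b} \<subseteq> T.X_sun_star"
      using f by (simp_all add: norm_continuous_on_eq sun_star_eq)
    note cont = T.conv_integrand_continuous[OF fT xT order_refl] T0.conv_integrand_continuous[OF f x' order_refl]
    have "norm (integral {a..b} (\<lambda>\<tau>. f \<tau> (x' o\<^sub>L T (b - \<tau>)) - f \<tau> (x' o\<^sub>L T0 (b - \<tau>)))) \<le>
        (B * (norm x' * (C * (b - a)))) * (b - a)"
    proof (rule integral_bound[OF ab(1) continuous_on_diff[OF cont]])
      fix \<tau> assume \<tau>: "\<tau> \<in> {a..b}"
      have in_sun: "x' o\<^sub>L T (b - \<tau>) \<in> T0.X_sun" "x' o\<^sub>L T0 (b - \<tau>) \<in> T0.X_sun"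
        using T.sun_compose[OF xT, of "b - \<tau>"] T0.sun_compose[OF x', of "b - \<tau>"] \<tau> by (auto simp: sun_dual_eq)
      have "f \<tau> (x' o\<^sub>L T (b - \<tau>)) - f \<tau> (x' o\<^sub>L T0 (b - \<tau>)) = f \<tau> ((x' o\<^sub>L T (b - \<tau>)) - (x' o\<^sub>L T0 (b - \<tau>)))"
        using f(2) \<tau> in_sun by (subst T0.sun_star_diff_arg) auto
      also have "(x' o\<^sub>L T (b - \<tau>)) - (x' o\<^sub>L T0 (b - \<tau>)) = x' o\<^sub>L (T (b - \<tau>) - T0 (b - \<tau>))"
        by (intro blinfun_eqI) (simp add: blinfun.diff_left blinfun.diff_right)
      also have "norm (f \<tau> \<dots>) \<le> B * norm (x' o\<^sub>L (T (b - \<tau>) - T0 (b - \<tau>)))"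
        using T0.sun_diff[OF in_sun] calculation \<tau>
        by (intro B) (auto simp: bounded_bilinear.diff_right[OF bounded_bilinear_blinfun_compose])
      also have "\<dots> \<le> B * (norm x' * (C * (b - a)))"
      proof (intro mult_left_mono B(1) order_trans[OF norm_blinfun_compose] norm_ge_zero)
        have "norm (T (b - \<tau>) - T0 (b - \<tau>)) \<le> C * (b - \<tau>)" using \<tau> ab by (intro C) auto
        also have "\<dots> \<le> C * (b - a)" using \<tau> C by (intro mult_left_mono) auto
        finally show "norm (T (b - \<tau>) - T0 (b - \<tau>)) \<le> C * (b - a)" .
      qed
      finally show "norm (f \<tau> (x' o\<^sub>L T (b - \<tau>)) - f \<tau> (x' o\<^sub>L T0 (b - \<tau>))) \<le> B * (norm x' * (C * (b - a)))" .
    qed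
    then show ?thesis
      by (simp add: T.conv_apply[OF xT] T0.conv_apply[OF x'] power2_eq_square mult_ac
          Henstock_Kurzweil_Integration.integral_diff integrable_continuous_real cont)
  qed
  then show ?thesis using C by (intro exI[of _ C]) auto
qed

section \<open>Admissibility for the perturbed semigroup\<close>

text \<open>On short intervals the convolution with \<open>T\<close> is within second order of the one with \<open>T\<^sub>0\<close>, which
  lies in \<open>jX\<close> by admissibility.\<close>
lemma perturbed_convolution_in_range:
  assumes f: "norm_continuous_on sc T0 {s..t} f" "f ` {s..t} \<subseteq> X0" and st: "s \<le> t"
  shows "T.conv f s t \<in> range T0.j"
proof -
  have f': "f ` {s..t} \<subseteq> T0.X_sun_star" using f(2) X0_subset by blast
  obtain B where B: "B \<ge> 0" "\<And>\<tau> x'. \<tau> \<in> {s..t} \<Longrightarrow> x' \<in> T0.X_sun \<Longrightarrow> norm (f \<tau> x') \<le> B * norm x'"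
    using T0.norm_continuous_on_bounded[OF f(1) f'] by blast
  obtain C where C: "\<And>a b f B x'. x' \<in> T0.X_sun \<Longrightarrow> a \<le> b \<Longrightarrow> b - a \<le> t - s \<Longrightarrow> 0 \<le> B \<Longrightarrow>
     norm_continuous_on sc T0 {a..b} f \<Longrightarrow>
     f ` {a..b} \<subseteq> T0.X_sun_star \<Longrightarrow> (\<forall>\<tau>\<in>{a..b}. \<forall>x'\<in>T0.X_sun. norm (f \<tau> x') \<le> B * norm x') \<Longrightarrow>
     norm (T.conv f a b x' - T0.conv f a b x') \<le> C * B * (b - a)\<^sup>2 * norm x'"
    using conv_close[of "t - s"] by blast
  have "T.conv f s t \<in> range T.j"
  proof (rule T.convolution_in_range_if_locally[where C = "C * B"])
    fix a b assume ab: "s \<le> a" "a \<le> b" "b \<le> t"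
    then have sub: "{a..b} \<subseteq> {s..t}" by auto
    have fab: "norm_continuous_on sc T0 {a..b} f" by (rule T0.norm_continuous_on_subset[OF f(1) sub])
    have "T0.conv f a b \<in> range T0.j"
      using f(2) sub ab by (intro T0.admissible_convolution[OF adm fab]) auto
    then obtain y where y: "T0.conv f a b = T0.j y" by auto
    have "norm (T.conv f a b x' - blinfun_apply x' y) \<le> C * B * (b - a)\<^sup>2 * norm x'" if x': "x' \<in> T0.X_sun" for x'
    proof -
      have "norm (T.conv f a b x' - T0.conv f a b x') \<le> C * B * (b - a)\<^sup>2 * norm x'"
        using ab sub f' B by (intro C x' fab) (auto simp: subset_eq)
      then show ?thesis by (simp add: y T0.j_apply[OF x'])
    qed
    then show "\<exists>y. \<forall>x'\<in>T.X_sun. norm (T.conv f a b x' - blinfun_apply x' y) \<le> C * B * (b - a)\<^sup>2 * norm x'"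
      by (auto simp: sun_dual_eq)
  qed (use f f' st in \<open>auto simp: norm_continuous_on_eq sun_star_eq\<close>)
  then show ?thesis by (simp add: sun_emb_eq)
qed

lemma admissible_perturbed: "admissible_range sc T X0"
proof -
  have "T.conv f s t \<in> range T.j"
    if "norm_continuous_on sc T {0..1} f" "f ` {0..1} \<subseteq> X0" "s \<in> {0..1}" "t \<in> {0..1}" "s \<le> t" for f s t
  proof -
    have "{s..t} \<subseteq> {0..1}" using that(3,4) by auto
    then have "norm_continuous_on sc T0 {s..t} f" "f ` {s..t} \<subseteq> X0"
      using that(1,2) T0.norm_continuous_on_subset by (auto simp: norm_continuous_on_eq)
    then have "T.conv f s t \<in> range T0.j" using that(5) by (rule perturbed_convolution_in_range)
    then show ?thesis by (simp add: sun_emb_eq)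
  qed
  moreover have "closed_sun_star_subspace sc T X0"
    using conjunct1[OF adm[unfolded admissible_range_def]]
    unfolding closed_sun_star_subspace_def sun_star_eq sun_star_norm_eq .
  moreover have "is_interval {0..1::real}" by (rule is_interval_cc)
  moreover have "\<exists>a\<in>{0..1::real}. \<exists>b\<in>{0..1}. a < b"
    by (rule bexI[of _ 0], rule bexI[of _ 1]) auto
  ultimately show ?thesis
    unfolding admissible_range_def by (intro conjI exI[of _ "{0..1}"] allI impI ballI) auto
qed

section \<open>The inhomogeneous equation\<close>

text \<open>On a compact interval \<open>[0, c]\<close> the candidate solution is studied with \<open>j\<^sup>-\<^sup>1\<close> formed for \<open>T\<^sub>0\<close>; by
  \<open>sun_emb_eq\<close> this is the same map as the one for \<open>T\<close>.\<close>
context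
  fixes f :: "real \<Rightarrow> ('a \<Rightarrow>\<^sub>L 'k) \<Rightarrow> 'k" and c :: real and \<phi> :: 'a and u0 :: "real \<Rightarrow> 'a"
  assumes c: "0 \<le> c"
    and f: "norm_continuous_on sc T0 {0..c} f" "f ` {0..c} \<subseteq> X0"
    and u0: "\<And>t. u0 t = T t \<phi> + inv T0.j (T.conv f 0 t)"
begin

lemma f_sub:
  assumes "0 \<le> a" "b \<le> c"
  shows "norm_continuous_on sc T0 {a..b} f" "f ` {a..b} \<subseteq> X0" "f ` {a..b} \<subseteq> T0.X_sun_star"
proof -
  have "{a..b} \<subseteq> {0..c}" using assms by auto
  then show "norm_continuous_on sc T0 {a..b} f" "f ` {a..b} \<subseteq> X0" "f ` {a..b} \<subseteq> T0.X_sun_star"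
    using f X0_subset T0.norm_continuous_on_subset[OF f(1)] by (auto intro!: subsetD[OF X0_subset])
qed

lemma f_sub_T:
  assumes "0 \<le> a" "b \<le> c"
  shows "norm_continuous_on sc T {a..b} f" "f ` {a..b} \<subseteq> T.X_sun_star"
  using f_sub[OF assms] by (simp_all add: norm_continuous_on_eq sun_star_eq)

lemma u0_apply: "0 \<le> t \<Longrightarrow> t \<le> c \<Longrightarrow> x' \<in> T0.X_sun \<Longrightarrow> blinfun_apply x' (u0 t) = x' (T t \<phi>) + T.conv f 0 t x'"
  using perturbed_convolution_in_range[OF f_sub(1,2)[of 0 t]]
  by (simp add: u0 blinfun.add_right T0.inv_j_apply)

lemma u0_step:
  assumes ab: "0 \<le> a" "a \<le> b" "b \<le> c" and x': "x' \<in> T0.X_sun"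
  shows "blinfun_apply x' (u0 b) = x' (T (b - a) (u0 a)) + T.conv f a b x'"
proof -
  have xT: "x' \<in> T.X_sun" using x' by (simp add: sun_dual_eq)
  have xa: "x' o\<^sub>L T (b - a) \<in> T0.X_sun" using T.sun_compose[OF xT, of "b - a"] ab by (simp add: sun_dual_eq)
  have "T.conv f 0 b x' = T.conv f 0 a (x' o\<^sub>L T (b - a)) + T.conv f a b x'"
    using ab by (intro T.conv_split f_sub_T xT) auto
  moreover have "blinfun_apply x' (u0 b) = x' (T b \<phi>) + T.conv f 0 b x'"
    using ab x' by (intro u0_apply) auto
  moreover have "blinfun_apply (x' o\<^sub>L T (b - a)) (u0 a) = (x' o\<^sub>L T (b - a)) (T a \<phi>) + T.conv f 0 a (x' o\<^sub>L T (b - a))"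
    using ab xa by (intro u0_apply) auto
  moreover have "T (b - a) (T a \<phi>) = T b \<phi>" using ab by (simp add: T.T_add_apply)
  ultimately show ?thesis by simp
qed

lemma u0_defect: "\<exists>D\<ge>0. \<forall>a b. 0 \<le> a \<and> a \<le> b \<and> b \<le> c \<longrightarrow> norm (u0 b - T (b - a) (u0 a)) \<le> D * (b - a)"
proof -
  obtain B where B: "B \<ge> 0" "\<And>\<tau> x'. \<tau> \<in> {0..c} \<Longrightarrow> x' \<in> T0.X_sun \<Longrightarrow> norm (f \<tau> x') \<le> B * norm x'"
    using T0.norm_continuous_on_bounded[OF f_sub(1,3)[of 0 c]] by auto
  obtain M where M: "M \<ge> 1" "\<And>r. r \<in> {0..c} \<Longrightarrow> norm (T r) \<le> M" using T.T_bounded by blast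
  obtain N where N: "N \<ge> 1"
      "\<And>x B. (\<forall>x'\<in>T0.X_sun. norm (blinfun_apply x' x) \<le> B * norm x') \<Longrightarrow> norm x \<le> N * \<bar>B\<bar>"
    using T0.sun_dual_norming by blast
  have "norm (u0 b - T (b - a) (u0 a)) \<le> (N * (B * M)) * (b - a)" if ab: "0 \<le> a" "a \<le> b" "b \<le> c" for a b
  proof -
    have "norm (blinfun_apply x' (u0 b - T (b - a) (u0 a))) \<le> (B * M * (b - a)) * norm x'" if x': "x' \<in> T0.X_sun" for x'
    proof -
      have "norm (T.conv f a b x') \<le> B * M * (b - a) * norm x'"
        using ab x' B M by (intro T.conv_bound f_sub_T) (auto simp: sun_dual_eq)
      then show ?thesis using u0_step[OF ab x'] by (simp add: blinfun.diff_right)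
    qed
    then have "norm (u0 b - T (b - a) (u0 a)) \<le> N * \<bar>B * M * (b - a)\<bar>" by (intro N(2)) blast
    then show ?thesis using B(1) M(1) ab by (simp add: abs_mult mult.assoc)
  qed
  then show ?thesis using N(1) B(1) M(1) by (intro exI[of _ "N * (B * M)"]) auto
qed

lemma u0_continuous: "continuous_on {0..c} u0"
proof -
  obtain D where "\<And>a b. 0 \<le> a \<Longrightarrow> a \<le> b \<Longrightarrow> b \<le> c \<Longrightarrow> norm (u0 b - T (b - a) (u0 a)) \<le> D * (b - a)"
    using u0_defect by blast
  then show ?thesis by (rule T.orbit_defect_continuous)
qed

lemma forcing:
  assumes u: "continuous_on {0..c} u" and ab: "0 \<le> a" "b \<le> c"
  shows "norm_continuous_on sc T0 {a..b} (\<lambda>\<tau>. L (u \<tau>) + f \<tau>)" "(\<lambda>\<tau>. L (u \<tau>) + f \<tau>) ` {a..b} \<subseteq> X0"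
    "(\<lambda>\<tau>. L (u \<tau>) + f \<tau>) ` {a..b} \<subseteq> T0.X_sun_star"
    "T0.conv (\<lambda>\<tau>. L (u \<tau>) + f \<tau>) a b x' = T0.conv (\<lambda>\<tau>. L (u \<tau>)) a b x' + T0.conv f a b x'"
proof -
  have u': "continuous_on {a..b} u" by (rule continuous_on_subset[OF u]) (use ab in auto)
  show "norm_continuous_on sc T0 {a..b} (\<lambda>\<tau>. L (u \<tau>) + f \<tau>)"
    by (intro T0.norm_continuous_on_add L_norm_continuous[OF u'] L_image f_sub ab)
  show "T0.conv (\<lambda>\<tau>. L (u \<tau>) + f \<tau>) a b x' = T0.conv (\<lambda>\<tau>. L (u \<tau>)) a b x' + T0.conv f a b x'"
    by (intro T0.conv_add L_norm_continuous[OF u'] L_image f_sub ab)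
  show *: "(\<lambda>\<tau>. L (u \<tau>) + f \<tau>) ` {a..b} \<subseteq> X0"
    using f_sub(2)[OF ab] L_range by (auto intro!: X0_add)
  show "(\<lambda>\<tau>. L (u \<tau>) + f \<tau>) ` {a..b} \<subseteq> T0.X_sun_star" using * X0_subset by (rule order_trans)
qed

text \<open>Let \<open>v\<close> be the right-hand side of the equation formed from \<open>u0\<close>. Over \<open>[a, b]\<close> the increments of \<open>u0\<close>
  and \<open>v\<close> relative to orbits of \<open>T\<^sub>0\<close> differ by the \<open>T\<^sub>0\<close>-convolution of
  \<open>L (T (\<tau> - a) (u0 a) - u0 \<tau>)\<close>, whose integrand has order \<open>b - a\<close>, plus the difference of the
  convolutions of \<open>f\<close> with \<open>T\<close> and \<open>T\<^sub>0\<close>. Both are of second order.\<close>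
lemma u0_mild:
  assumes t: "0 \<le> t" "t \<le> c"
  shows "u0 t = T0 t \<phi> + inv T0.j (T0.conv (\<lambda>\<tau>. L (u0 \<tau>) + f \<tau>) 0 t)"
proof -
  define q where "q \<tau> = L (u0 \<tau>) + f \<tau>" for \<tau>
  define v where "v s = T0 s \<phi> + inv T0.j (T0.conv q 0 s)" for s
  define e where "e s = u0 s - v s" for s
  note q = forcing[OF u0_continuous, folded q_def]
  have v: "blinfun_apply x' (v s) = x' (T0 s \<phi>) + T0.conv q 0 s x'" if "0 \<le> s" "s \<le> c" "x' \<in> T0.X_sun" for s x'
    using T0.admissible_convolution[OF adm q(1,2)[of 0 s]] that
    by (simp add: v_def blinfun.add_right T0.inv_j_apply)
  have v_step: "blinfun_apply x' (v b) = x' (T0 (b - a) (v a)) + T0.conv q a b x'"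
    if ab: "0 \<le> a" "a \<le> b" "b \<le> c" and x': "x' \<in> T0.X_sun" for a b x'
  proof -
    have xa: "x' o\<^sub>L T0 (b - a) \<in> T0.X_sun" using T0.sun_compose[OF x'] ab by simp
    have "T0.conv q 0 b x' = T0.conv q 0 a (x' o\<^sub>L T0 (b - a)) + T0.conv q a b x'"
      using ab by (intro T0.conv_split q x') auto
    moreover have "T0 (b - a) (T0 a \<phi>) = T0 b \<phi>" using ab by (simp add: T0.T_add_apply)
    ultimately show ?thesis using v[of b x'] v[of a "x' o\<^sub>L T0 (b - a)"] ab x' xa by simp
  qed
  obtain D where D: "D \<ge> 0" "\<And>a b. 0 \<le> a \<Longrightarrow> a \<le> b \<Longrightarrow> b \<le> c \<Longrightarrow> norm (u0 b - T (b - a) (u0 a)) \<le> D * (b - a)"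
    using u0_defect by blast
  obtain Q where Q: "Q \<ge> 0" "\<And>a b g G x'. x' \<in> T0.X_sun \<Longrightarrow> a \<le> b \<Longrightarrow> b - a \<le> c \<Longrightarrow> 0 \<le> G \<Longrightarrow>
      continuous_on {a..b} g \<Longrightarrow> (\<forall>\<tau>\<in>{a..b}. norm (g \<tau>) \<le> G) \<Longrightarrow>
      norm (T0.conv (\<lambda>\<tau>. L (g \<tau>)) a b x') \<le> Q * G * (b - a) * norm x'"
    using L_conv_bounded[of c] by blast
  obtain C where C: "C \<ge> 0" "\<And>a b f B x'. x' \<in> T0.X_sun \<Longrightarrow> a \<le> b \<Longrightarrow> b - a \<le> c \<Longrightarrow> 0 \<le> B \<Longrightarrow>
     norm_continuous_on sc T0 {a..b} f \<Longrightarrow>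
     f ` {a..b} \<subseteq> T0.X_sun_star \<Longrightarrow> (\<forall>\<tau>\<in>{a..b}. \<forall>x'\<in>T0.X_sun. norm (f \<tau> x') \<le> B * norm x') \<Longrightarrow>
     norm (T.conv f a b x' - T0.conv f a b x') \<le> C * B * (b - a)\<^sup>2 * norm x'"
    using conv_close[of c] by blast
  obtain B where B: "B \<ge> 0" "\<And>\<tau> x'. \<tau> \<in> {0..c} \<Longrightarrow> x' \<in> T0.X_sun \<Longrightarrow> norm (f \<tau> x') \<le> B * norm x'"
    using T0.norm_continuous_on_bounded[OF f_sub(1,3)[of 0 c]] by auto
  obtain N where N: "N \<ge> 1"
      "\<And>x B. (\<forall>x'\<in>T0.X_sun. norm (blinfun_apply x' x) \<le> B * norm x') \<Longrightarrow> norm x \<le> N * \<bar>B\<bar>"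
    using T0.sun_dual_norming by blast
  have "norm (e b - T0 (b - a) (e a)) \<le> (N * (Q * D + C * B)) * (b - a)\<^sup>2" if ab: "0 \<le> a" "a \<le> b" "b \<le> c" for a b
  proof -
    define g where "g \<tau> = T (\<tau> - a) (u0 a) - u0 \<tau>" for \<tau>
    have cont_u0: "continuous_on {a..b} u0" by (rule continuous_on_subset[OF u0_continuous]) (use ab in auto)
    have cont_g: "continuous_on {a..b} g"
      unfolding g_def
      by (intro continuous_intros cont_u0 continuous_on_compose2[OF T.T_continuous, of _ "\<lambda>\<tau>. \<tau> - a"]) auto
    have g_le: "norm (g \<tau>) \<le> D * (b - a)" if "\<tau> \<in> {a..b}" for \<tau>
    proof -
      have "norm (g \<tau>) \<le> D * (\<tau> - a)" using D(2)[of a \<tau>] that ab by (simp add: g_def norm_minus_commute)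
      also have "\<dots> \<le> D * (b - a)" using that D(1) by (intro mult_left_mono) auto
      finally show ?thesis .
    qed
    have "norm (blinfun_apply x' (e b - T0 (b - a) (e a))) \<le> ((Q * D + C * B) * (b - a)\<^sup>2) * norm x'"
      if x': "x' \<in> T0.X_sun" for x'
    proof -
      have "T0.conv (\<lambda>\<tau>. L (u0 \<tau>) + L (g \<tau>)) a b x' = T0.conv (\<lambda>\<tau>. L (u0 \<tau>)) a b x' + T0.conv (\<lambda>\<tau>. L (g \<tau>)) a b x'"
        by (intro T0.conv_add L_norm_continuous cont_u0 cont_g L_image)
      then have "T0.conv (\<lambda>\<tau>. L (T (\<tau> - a) (u0 a))) a b x' = T0.conv (\<lambda>\<tau>. L (u0 \<tau>)) a b x' + T0.conv (\<lambda>\<tau>. L (g \<tau>)) a b x'"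
        by (simp add: g_def flip: L_add)
      then have eq: "blinfun_apply x' (e b - T0 (b - a) (e a)) =
          T0.conv (\<lambda>\<tau>. L (g \<tau>)) a b x' + (T.conv f a b x' - T0.conv f a b x')"
        using u0_step[OF ab x'] v_step[OF ab x'] variation_of_constants[OF ab(2) x', of "u0 a"] q(4)[OF ab(1,3), of x']
        by (simp add: e_def blinfun.diff_right)
      have 1: "norm (T0.conv (\<lambda>\<tau>. L (g \<tau>)) a b x') \<le> Q * (D * (b - a)) * (b - a) * norm x'"
        using ab D(1) g_le by (intro Q x' cont_g) auto
      have 2: "norm (T.conv f a b x' - T0.conv f a b x') \<le> C * B * (b - a)\<^sup>2 * norm x'"
        using ab B by (intro C x' f_sub) auto
      show ?thesis unfolding eq
        by (rule order_trans[OF norm_triangle_mono[OF 1 2]]) (simp add: algebra_simps power2_eq_square)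
    qed
    then have "norm (e b - T0 (b - a) (e a)) \<le> N * \<bar>(Q * D + C * B) * (b - a)\<^sup>2\<bar>" by (intro N(2)) blast
    then show ?thesis using Q(1) C(1) B(1) D(1) by (simp add: abs_mult mult.assoc)
  qed
  moreover have "e 0 = 0"
  proof -
    have "u0 0 = v 0"
    proof (rule T0.sun_separates)
      fix x' assume x': "x' \<in> T0.X_sun"
      then have "x' \<in> T.X_sun" by (simp add: sun_dual_eq)
      then show "blinfun_apply x' (u0 0) = x' (v 0)"
        using u0_apply[of 0 x'] v[of 0 x'] x' c by (simp add: T.conv_apply T0.conv_apply T.T_zero T0.T_zero)
    qed
    then show ?thesis by (simp add: e_def)
  qed
  ultimately have "e t = 0" by (rule T0.orbit_defect_zero[where c = t]) (use t in auto)
  then show ?thesis by (simp add: e_def v_def q_def[abs_def])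
qed

text \<open>The difference \<open>z\<close> of two solutions satisfies the homogeneous equation, so
  \<open>z b - T (b - a) (z a)\<close> is \<open>j\<^sup>-\<^sup>1\<close> of the \<open>T\<^sub>0\<close>-convolution of \<open>L (z \<tau> - T (\<tau> - a) (z a))\<close>. Boundedness of
  \<open>z\<close> makes this defect of first order; inserting that into the same formula raises it to second
  order, and \<open>orbit_defect_zero\<close> applies.\<close>
lemma mild_unique:
  assumes u_cont: "continuous_on {0..c} u"
    and u: "\<And>t. 0 \<le> t \<Longrightarrow> t \<le> c \<Longrightarrow> u t = T0 t \<phi> + inv T0.j (T0.conv (\<lambda>\<tau>. L (u \<tau>) + f \<tau>) 0 t)"
  shows "u c = u0 c"
proof -
  define z where "z s = u s - u0 s" for s
  have cont_z: "continuous_on {0..c} z" unfolding z_def by (intro continuous_intros u_cont u0_continuous)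
  have mild: "blinfun_apply x' (w s) = x' (T0 s \<phi>) + (T0.conv (\<lambda>\<tau>. L (w \<tau>)) 0 s x' + T0.conv f 0 s x')"
    if s: "0 \<le> s" "s \<le> c" and x': "x' \<in> T0.X_sun" and cont: "continuous_on {0..c} w"
      and w: "w s = T0 s \<phi> + inv T0.j (T0.conv (\<lambda>\<tau>. L (w \<tau>) + f \<tau>) 0 s)" for s x' w
  proof -
    have "T0.conv (\<lambda>\<tau>. L (w \<tau>) + f \<tau>) 0 s \<in> range T0.j"
      using s by (intro T0.admissible_convolution[OF adm] forcing[OF cont]) auto
    then show ?thesis
      by (subst w) (use forcing(4)[OF cont, of 0 s] s x' in \<open>simp add: blinfun.add_right T0.inv_j_apply\<close>)
  qed
  have z: "blinfun_apply x' (z s) = T0.conv (\<lambda>\<tau>. L (z \<tau>)) 0 s x'" if s: "0 \<le> s" "s \<le> c" and x': "x' \<in> T0.X_sun" for s x'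
  proof -
    have cont: "continuous_on {0..s} z" "continuous_on {0..s} u0"
      using s by (auto intro: continuous_on_subset[OF cont_z] continuous_on_subset[OF u0_continuous])
    have "T0.conv (\<lambda>\<tau>. L (z \<tau>) + L (u0 \<tau>)) 0 s x' = T0.conv (\<lambda>\<tau>. L (z \<tau>)) 0 s x' + T0.conv (\<lambda>\<tau>. L (u0 \<tau>)) 0 s x'"
      by (intro T0.conv_add L_norm_continuous cont L_image)
    then show ?thesis
      using mild[OF s x' u_cont u[OF s]] mild[OF s x' u0_continuous u0_mild[OF s]]
      by (simp add: z_def blinfun.diff_right flip: L_add)
  qed
  obtain Q where Q: "Q \<ge> 0" "\<And>a b g G x'. x' \<in> T0.X_sun \<Longrightarrow> a \<le> b \<Longrightarrow> b - a \<le> c \<Longrightarrow> 0 \<le> G \<Longrightarrow>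
      continuous_on {a..b} g \<Longrightarrow> (\<forall>\<tau>\<in>{a..b}. norm (g \<tau>) \<le> G) \<Longrightarrow>
      norm (T0.conv (\<lambda>\<tau>. L (g \<tau>)) a b x') \<le> Q * G * (b - a) * norm x'"
    using L_conv_bounded[of c] by blast
  obtain N where N: "N \<ge> 1"
      "\<And>x B. (\<forall>x'\<in>T0.X_sun. norm (blinfun_apply x' x) \<le> B * norm x') \<Longrightarrow> norm x \<le> N * \<bar>B\<bar>"
    using T0.sun_dual_norming by blast
  obtain M where M: "M \<ge> 1" "\<And>r. r \<in> {0..c} \<Longrightarrow> norm (T r) \<le> M" using T.T_bounded by blast
  have "bounded (z ` {0..c})" by (intro compact_imp_bounded compact_continuous_image cont_z) auto
  then have "\<exists>Z. \<forall>s\<in>{0..c}. norm (z s) \<le> Z" by (simp add: bounded_iff)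
  then obtain Z where Z: "\<And>s. s \<in> {0..c} \<Longrightarrow> norm (z s) \<le> Z" by blast
  have Z0: "Z \<ge> 0" using Z[of 0] c order_trans[OF norm_ge_zero] by fastforce
  have step: "norm (z b - T (b - a) (z a)) \<le> (N * Q * G) * (b - a)"
    if ab: "0 \<le> a" "a \<le> b" "b \<le> c" and G: "0 \<le> G" "\<And>\<tau>. \<tau> \<in> {a..b} \<Longrightarrow> norm (z \<tau> - T (\<tau> - a) (z a)) \<le> G" for a b G
  proof -
    define g where "g \<tau> = z \<tau> - T (\<tau> - a) (z a)" for \<tau>
    have cz: "continuous_on {a..b} z" by (rule continuous_on_subset[OF cont_z]) (use ab in auto)
    have cT: "continuous_on {a..b} (\<lambda>\<tau>. T (\<tau> - a) (z a))"
      by (intro continuous_on_compose2[OF T.T_continuous, of _ "\<lambda>\<tau>. \<tau> - a"] continuous_intros) auto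
    have cg: "continuous_on {a..b} g" unfolding g_def by (intro continuous_intros cz cT)
    have "norm (blinfun_apply x' (z b - T (b - a) (z a))) \<le> (Q * G * (b - a)) * norm x'" if x': "x' \<in> T0.X_sun" for x'
    proof -
      have xa: "x' o\<^sub>L T0 (b - a) \<in> T0.X_sun" using T0.sun_compose[OF x'] ab by simp
      have cz0: "continuous_on {0..b} z" by (rule continuous_on_subset[OF cont_z]) (use ab in auto)
      have "T0.conv (\<lambda>\<tau>. L (z \<tau>)) 0 b x' =
          T0.conv (\<lambda>\<tau>. L (z \<tau>)) 0 a (x' o\<^sub>L T0 (b - a)) + T0.conv (\<lambda>\<tau>. L (z \<tau>)) a b x'"
        using ab by (intro T0.conv_split L_norm_continuous cz0 L_image x')
      then have "blinfun_apply x' (z b) = x' (T0 (b - a) (z a)) + T0.conv (\<lambda>\<tau>. L (z \<tau>)) a b x'"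
        using z[of b x'] z[of a "x' o\<^sub>L T0 (b - a)"] ab x' xa by simp
      moreover have "T0.conv (\<lambda>\<tau>. L (T (\<tau> - a) (z a)) + L (g \<tau>)) a b x' =
          T0.conv (\<lambda>\<tau>. L (T (\<tau> - a) (z a))) a b x' + T0.conv (\<lambda>\<tau>. L (g \<tau>)) a b x'"
        by (intro T0.conv_add L_norm_continuous cT cg L_image)
      then have "T0.conv (\<lambda>\<tau>. L (z \<tau>)) a b x' =
          T0.conv (\<lambda>\<tau>. L (T (\<tau> - a) (z a))) a b x' + T0.conv (\<lambda>\<tau>. L (g \<tau>)) a b x'"
        by (simp add: g_def flip: L_add)
      ultimately have "blinfun_apply x' (z b - T (b - a) (z a)) = T0.conv (\<lambda>\<tau>. L (g \<tau>)) a b x'"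
        using variation_of_constants[OF ab(2) x', of "z a"] by (simp add: blinfun.diff_right)
      then show ?thesis using Q(2)[OF x' ab(2) _ G(1) cg] G(2) ab by (simp add: g_def)
    qed
    then have "norm (z b - T (b - a) (z a)) \<le> N * \<bar>Q * G * (b - a)\<bar>" by (intro N(2)) blast
    then show ?thesis using Q(1) G(1) ab by (simp add: abs_mult mult.assoc)
  qed
  define D where "D = N * Q * (Z + M * Z)"
  have D0: "D \<ge> 0" using N Q M Z0 by (simp add: D_def)
  have first: "norm (z b - T (b - a) (z a)) \<le> D * (b - a)" if ab: "0 \<le> a" "a \<le> b" "b \<le> c" for a b
    unfolding D_def
  proof (rule step[OF ab])
    fix \<tau> assume \<tau>: "\<tau> \<in> {a..b}"
    have "norm (T (\<tau> - a) (z a)) \<le> M * Z"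
      using \<tau> ab M(1) by (intro order_trans[OF norm_blinfun] mult_mono M Z) auto
    then show "norm (z \<tau> - T (\<tau> - a) (z a)) \<le> Z + M * Z"
      using Z[of \<tau>] \<tau> ab norm_triangle_ineq4[of "z \<tau>" "T (\<tau> - a) (z a)"] by force
  qed (use Z0 M in auto)
  have "norm (z b - T (b - a) (z a)) \<le> (N * Q * D) * (b - a)\<^sup>2" if ab: "0 \<le> a" "a \<le> b" "b \<le> c" for a b
  proof -
    have "norm (z b - T (b - a) (z a)) \<le> (N * Q * (D * (b - a))) * (b - a)"
    proof (rule step[OF ab])
      fix \<tau> assume \<tau>: "\<tau> \<in> {a..b}"
      have "norm (z \<tau> - T (\<tau> - a) (z a)) \<le> D * (\<tau> - a)" using \<tau> ab by (intro first) auto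
      also have "\<dots> \<le> D * (b - a)" using \<tau> D0 by (intro mult_left_mono) auto
      finally show "norm (z \<tau> - T (\<tau> - a) (z a)) \<le> D * (b - a)" .
    qed (use D0 ab in auto)
    then show ?thesis by (simp add: power2_eq_square mult_ac)
  qed
  moreover have "z 0 = 0"
    by (rule T0.sun_separates) (use z[of 0] c in \<open>simp add: T0.conv_apply\<close>)
  ultimately have "z c = 0" using c by (rule T.orbit_defect_zero)
  then show ?thesis by (simp add: z_def)
qed

end

end

theorem theorem22:
  fixes sc :: "'k::{real_normed_field,euclidean_space} \<Rightarrow> 'a::banach \<Rightarrow> 'a"
    and T0 T :: "real \<Rightarrow> 'a \<Rightarrow>\<^sub>L 'a"
    and X0 :: "(('a \<Rightarrow>\<^sub>L 'k) \<Rightarrow> 'k) set"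
    and L :: "'a \<Rightarrow> ('a \<Rightarrow>\<^sub>L 'k) \<Rightarrow> 'k"
    and te :: ereal
    and I :: "real set"
  assumes "banach_over sc"
    and "C0_semigroup sc T0"
    and "admissible_range sc T0 X0"
    and "bounded_linear_into_sun_star sc T0 L"
    and "range L \<subseteq> X0"
    and "perturbed_semigroup sc T0 L T"
    and "0 < te"
    and "I = {t. 0 \<le> t \<and> ereal t < te}"
  shows "admissible_range sc T X0 \<and>
    (\<forall>\<phi> f u0. norm_continuous_on sc T0 I f \<and> f ` I \<subseteq> X0 \<and>
       u0 = (\<lambda>t. T t \<phi> + inv (sun_emb sc T) (sun_star_convolution sc T f 0 t)) \<longrightarrow>
         (\<forall>t\<in>I. sun_star_convolution sc T f 0 t \<in> range (sun_emb sc T)) \<and>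
         mild_solution_on I sc T0 L \<phi> f u0 \<and>
         (\<forall>u. mild_solution_on I sc T0 L \<phi> f u \<longrightarrow> (\<forall>t\<in>I. u t = u0 t)))"
proof -
  interpret banach_over sc by fact
  interpret sun_perturbation sc T0 T X0 L
    using assms by unfold_locales (auto simp: perturbed_semigroup_def)
  have I_sub: "{0..t} \<subseteq> I" if "t \<in> I" for t
    using that assms(8) le_less_trans[of "ereal _" "ereal t" te] by auto
  have main: "(\<forall>t\<in>I. sun_star_convolution sc T f 0 t \<in> range (sun_emb sc T)) \<and>
         mild_solution_on I sc T0 L \<phi> f u0 \<and>
         (\<forall>u. mild_solution_on I sc T0 L \<phi> f u \<longrightarrow> (\<forall>t\<in>I. u t = u0 t))"
    if f: "norm_continuous_on sc T0 I f" "f ` I \<subseteq> X0"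
      and u0_def: "u0 = (\<lambda>t. T t \<phi> + inv (sun_emb sc T) (sun_star_convolution sc T f 0 t))" for \<phi> f u0
  proof -
    have u0: "u0 t = T t \<phi> + inv (sun_emb sc T0) (sun_star_convolution sc T f 0 t)" for t
      by (simp add: u0_def sun_emb_eq)
    have fc: "0 \<le> c" "norm_continuous_on sc T0 {0..c} f" "f ` {0..c} \<subseteq> X0" if "c \<in> I" for c
      using I_sub[OF that] f T0.norm_continuous_on_subset[OF f(1)] that assms(8) by auto
    have "sun_star_convolution sc T f 0 t \<in> range (sun_emb sc T)" if "t \<in> I" for t
      using perturbed_convolution_in_range[OF fc(2,3,1)] that by (simp add: sun_emb_eq)
    \<comment> \<open>\<open>I\<close> has no largest element, so continuity at \<open>t\<close> is taken from \<open>[0, c]\<close> with \<open>t < c < te\<close>.\<close>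
    moreover have "continuous_on I u0"
      unfolding continuous_on_eq_continuous_within
    proof
      fix t assume t: "t \<in> I"
      then obtain c where c: "ereal t < ereal c" "ereal c < te"
        using ereal_dense2[of "ereal t" te] assms(8) by auto
      then have cI: "c \<in> I" "t < c" using t assms(8) by auto
      have "continuous (at t within {0..c}) u0"
        using u0_continuous[OF fc[OF cI(1)] u0] cI t assms(8) by (auto simp: continuous_on_eq_continuous_within)
      moreover have "at t within {0..c} = at t within I"
        by (rule at_within_nhd[of t "{..<c}"]) (use cI I_sub[OF cI(1)] assms(8) in auto)
      ultimately show "continuous (at t within I) u0" by simp
    qed
    then have "mild_solution_on I sc T0 L \<phi> f u0"
      using u0_mild[OF fc u0] fc(1) by (auto simp: mild_solution_on_def)
    moreover have "u t = u0 t" if u: "mild_solution_on I sc T0 L \<phi> f u" and t: "t \<in> I" for u t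
    proof (rule mild_unique[OF fc[OF t] u0])
      show "continuous_on {0..t} u" using u I_sub[OF t] by (auto simp: mild_solution_on_def intro: continuous_on_subset)
      show "u s = T0 s \<phi> + inv (sun_emb sc T0) (sun_star_convolution sc T0 (\<lambda>\<tau>. L (u \<tau>) + f \<tau>) 0 s)"
        if "0 \<le> s" "s \<le> t" for s
        using u I_sub[OF t] that by (auto simp: mild_solution_on_def)
    qed
    ultimately show ?thesis by blast
  qed
  then show ?thesis using admissible_perturbed by blast
qed

end
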